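(* There is a bijective, order-reversing (with respect to inclusion) correspondence between the set of subsets $Z\subseteq T^d$ that are closed both topologically and under the mappings $\tilde{w}\mapsto\tilde{w}^{(j)}$ for all $j\in\mathbb{N}$, and the set of radical power-closed ideals of $R^{\pm}=\mathbb{C}[x_1^{\pm1},\ldots,x_d^{\pm1}]$. The sets $Z$ are exactly the finite unions of topologically closed subgroups of the torus group $T^d$.
   Context: $\mathbb{N}=\{1,2,\ldots\}$. $T$ is the circle group of complex numbers of modulus $1$ under multiplication, and $T^d\subseteq(\mathbb{C}^* )^d$ is the $d$-dimensional torus group with componentwise multiplication and its usual topology. For $\tilde{w}=(w_1,\ldots,w_d)$, $\tilde{w}^{(j)}=(w_1^j,\ldots,w_d^j)$. For $f\in R^{\pm}$, $f^{(i)}=f(x_1^i,\ldots,x_d^i)$; an ideal $I$ of $R^{\pm}$ is power-closed if $f\in I$ implies $f^{(i)}\in I$ for every $i\in\mathbb{N}$, and radical if $I=\sqrt{I}$. *)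

theory Defs
  imports
    "HOL-Analysis.Analysis"
    "HOL-Library.Poly_Mapping"
    "HOL-Algebra.Algebraic_Closure_Type"
begin

text \<open>
  The Laurent polynomial ring \<open>R\<^sup>\<plusminus> = \<complex>[x\<^sub>1\<^sup>\<plusminus>\<^sup>1, \<dots>, x\<^sub>d\<^sup>\<plusminus>\<^sup>1]\<close>, as the group algebra of \<open>\<int>\<^sup>d\<close>: a finitely
  supported map from exponent vectors to coefficients, with the convolution product of
  \<^theory>\<open>HOL-Library.Poly_Mapping\<close>. The variables are indexed by \<open>'d\<close>, so that \<open>d = CARD('d)\<close>;
  \<open>Poly_Mapping.single a c\<close> is the Laurent monomial \<open>c x\<^sup>a\<close>.
\<close>

type_synonym 'd laurent = "(int ^ 'd) \<Rightarrow>\<^sub>0 complex"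

text \<open>\<open>f\<^sup>(\<^sup>i\<^sup>) = f(x\<^sub>1\<^sup>i, \<dots>, x\<^sub>d\<^sup>i)\<close>: the monomial \<open>x\<^sup>a\<close> is sent to \<open>x\<^sup>i\<^sup>a\<close>.\<close>

definition power_subst :: "nat \<Rightarrow> 'd::finite laurent \<Rightarrow> 'd laurent" where
  "power_subst i f =
     (\<Sum>a\<in>Poly_Mapping.keys f. Poly_Mapping.single (int i *s a) (Poly_Mapping.lookup f a))"

text \<open>\<open>ring_of_type_algebra\<close> is the HOL-Algebra ring with carrier \<open>UNIV\<close> and the type class operations.\<close>

abbreviation laurent_ring :: "'d::finite laurent ring" where
  "laurent_ring \<equiv> ring_of_type_algebra"

definition power_closed :: "'d::finite laurent set \<Rightarrow> bool" where
  "power_closed I \<longleftrightarrow> (\<forall>f\<in>I. \<forall>i\<ge>1. power_subst i f \<in> I)"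

definition ideal_radical :: "'a::comm_ring_1 set \<Rightarrow> 'a set" where
  "ideal_radical I = {f. \<exists>n\<ge>1. f ^ n \<in> I}"

text \<open>As in the usual convention, the unit ideal counts as radical.\<close>

definition radical_power_closed_ideals :: "'d::finite laurent set set" where
  "radical_power_closed_ideals =
     {I. ideal I laurent_ring \<and> ideal_radical I = I \<and> power_closed I}"

definition torus :: "(complex ^ 'd::finite) set" where
  "torus = {w. \<forall>i. w $ i \<in> sphere 0 1}"

definition torus_group :: "(complex ^ 'd::finite) monoid" where
  "torus_group = \<lparr>carrier = torus, monoid.mult = (\<lambda>v w. \<chi> i. v $ i * w $ i), one = (\<chi> i. 1)\<rparr>"

definition torus_power :: "nat \<Rightarrow> complex ^ 'd::finite \<Rightarrow> complex ^ 'd" where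
  "torus_power j w = (\<chi> i. (w $ i) ^ j)"

text \<open>\<open>closedin (top_of_set torus) Z\<close> includes \<open>Z \<subseteq> torus\<close>.\<close>

definition closed_power_sets :: "(complex ^ 'd::finite) set set" where
  "closed_power_sets =
     {Z. closedin (top_of_set torus) Z \<and> (\<forall>j\<ge>1. \<forall>w\<in>Z. torus_power j w \<in> Z)}"

end

theory Submission
  imports Defs
begin

text \<open>
  The correspondence sends \<open>Z\<close> to the ideal of Laurent polynomials that vanish on \<open>Z\<close>. Three facts
  make it work.

  \<^emph>\<open>Characters separate.\<close> Let \<open>Z \<subseteq> T\<^sup>d\<close> be closed and power-closed and let \<open>w \<in> T\<^sup>d\<close> lie outside \<open>Z\<close>.
  There is a finite set \<open>F\<close> of exponents such that every \<open>z \<in> Z\<close> has some \<open>a \<in> F\<close> with \<open>z\<^sup>a = 1\<close> and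
  \<open>w\<^sup>a \<noteq> 1\<close> (\<open>separating_exponents\<close>). Take a trigonometric polynomial with nonnegative values that peaks
  at \<open>w\<close>, namely \<open>\<Prod>\<^sub>i \<bar>(1 + z\<^sub>i/w\<^sub>i)/2\<bar>\<^sup>2\<^sup>N\<close>. On \<open>Z\<close> it is at most \<open>q\<^sup>N\<close> for a fixed \<open>q < 1\<close>. Its mean over the
  powers \<open>z, z\<^sup>2, z\<^sup>3, \<dots>\<close> of a point \<open>z \<in> Z\<close>, which all lie in \<open>Z\<close>, retains exactly the terms with exponent
  \<open>a\<close> such that \<open>z\<^sup>a = 1\<close>. If \<open>w\<^sup>a = 1\<close> for all these \<open>a\<close>, then the retained terms are nonnegative
  and together at least \<open>(N+1)\<^sup>-\<^sup>d\<close>; for large \<open>N\<close> this exceeds \<open>q\<^sup>N\<close>. So the exponents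
  of this polynomial serve as \<open>F\<close>. The product of the \<open>x\<^sup>a - 1\<close> with \<open>a \<in> F\<close> and \<open>w\<^sup>a \<noteq> 1\<close> then vanishes on \<open>Z\<close>
  but not at \<open>w\<close>, so \<open>Z\<close> is recovered from its ideal and inclusions are reversed in both directions.

  \<^emph>\<open>Finitely many subgroups suffice.\<close> For a subgroup \<open>A\<close> of \<open>\<int>\<^sup>d\<close> let \<open>A\<^sup>\<bottom>\<close> be the closed subgroup of all
  \<open>z \<in> T\<^sup>d\<close> with \<open>z\<^sup>a = 1\<close> for \<open>a \<in> A\<close>. Either \<open>A\<^sup>\<bottom> \<subseteq> Z\<close>, or a point of \<open>A\<^sup>\<bottom>\<close> outside \<open>Z\<close> supplies \<open>F\<close> as above and
  \<open>Z \<inter> A\<^sup>\<bottom>\<close> is the union of the finitely many sets \<open>Z \<inter> (A + \<int>a)\<^sup>\<bottom>\<close> with \<open>a \<in> F\<close> and \<open>w\<^sup>a \<noteq> 1\<close>, where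
  \<open>A + \<int>a\<close> is strictly larger than \<open>A\<close>. Ascending chains of subgroups of \<open>\<int>\<^sup>d\<close> stabilize, so this
  recursion, started at \<open>A = 0\<close>, ends (\<open>closed_power_set_Int_common_kernel\<close>).

  \<^emph>\<open>Every radical power-closed ideal is attained.\<close> Let \<open>I\<close> be such an ideal and \<open>f \<notin> I\<close>. The Nullstellensatz gives a
  common zero \<open>w \<in> (\<complex>\<^sup>*)\<^sup>d\<close> of \<open>I\<close> with \<open>f(w) \<noteq> 0\<close>. It need not lie on the torus. For \<open>g \<in> I\<close> all powers of \<open>w\<close> are
  zeros of \<open>g\<close>, so by Vandermonde the coefficients of \<open>g\<close> sum to zero over each set of exponents
  on which \<open>w\<^sup>a\<close> is constant. This depends only on which values \<open>w\<^sup>a\<close> agree. Hence \<open>w\<close> may be replaced by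
  its image, and by the powers of its image, under any homomorphism \<open>\<complex>\<^sup>* \<rightarrow> T\<close>; one that is injective on the values
  \<open>w\<^sup>a\<close> for the exponents \<open>a\<close> of \<open>f\<close> keeps some value of \<open>f\<close> nonzero (\<open>torus_zero_of_power_closed\<close>).
\<close>

(* The symbol $ is left to vector components. *)
no_notation fps_nth (infixl \<open>$\<close> 75)

section \<open>Evaluation of Laurent polynomials\<close>

definition monomial_at :: "complex ^ 'd::finite \<Rightarrow> int ^ 'd \<Rightarrow> complex" where
  "monomial_at w a = (\<Prod>i\<in>UNIV. (w $ i) powi (a $ i))"

definition laurent_eval :: "'d::finite laurent \<Rightarrow> complex ^ 'd \<Rightarrow> complex" where
  "laurent_eval f w = (\<Sum>a\<in>Poly_Mapping.keys f. Poly_Mapping.lookup f a * monomial_at w a)"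

lemma laurent_eval_superset:
  assumes "finite A" "Poly_Mapping.keys f \<subseteq> A"
  shows "laurent_eval f w = (\<Sum>a\<in>A. Poly_Mapping.lookup f a * monomial_at w a)"
  unfolding laurent_eval_def using assms
  by (intro sum.mono_neutral_left) (auto simp: in_keys_iff)

lemma laurent_eval_single [simp]: "laurent_eval (Poly_Mapping.single a c) w = c * monomial_at w a"
  by (subst laurent_eval_superset[of "{a}"]) auto

lemma laurent_eval_0 [simp]: "laurent_eval 0 w = 0"
  by (simp add: laurent_eval_def)

lemma laurent_eval_add [simp]: "laurent_eval (f + g) w = laurent_eval f w + laurent_eval g w"
  using Poly_Mapping.keys_add[of f g]
  by (simp add: laurent_eval_superset[of "Poly_Mapping.keys f \<union> Poly_Mapping.keys g"]
      lookup_add sum.distrib ring_distribs)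

lemma laurent_eval_sum [simp]: "laurent_eval (sum F A) w = (\<Sum>x\<in>A. laurent_eval (F x) w)"
  by (induction A rule: infinite_finite_induct) auto

lemma laurent_expansion:
  "f = (\<Sum>a\<in>Poly_Mapping.keys f. Poly_Mapping.single a (Poly_Mapping.lookup f a))"
proof (rule poly_mapping_eqI)
  fix k show "Poly_Mapping.lookup f k =
    Poly_Mapping.lookup (\<Sum>a\<in>Poly_Mapping.keys f. Poly_Mapping.single a (Poly_Mapping.lookup f a)) k"
    by (simp add: lookup_sum lookup_single when_def in_keys_iff)
qed

lemma torus_nonzero: "w \<in> torus \<Longrightarrow> w $ i \<noteq> 0"
  by (auto simp: torus_def dest: spec[of _ i])

lemma monomial_at_0 [simp]: "monomial_at w 0 = 1"
  by (simp add: monomial_at_def)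

lemma monomial_at_add:
  assumes "\<And>i. w $ i \<noteq> 0"
  shows "monomial_at w (a + b) = monomial_at w a * monomial_at w b"
  using assms by (simp add: monomial_at_def power_int_add prod.distrib)

lemma monomial_at_diff:
  assumes "\<And>i. w $ i \<noteq> 0"
  shows "monomial_at w (a - b) = monomial_at w a / monomial_at w b"
  using assms by (simp add: monomial_at_def power_int_diff prod_dividef)

lemma monomial_at_uminus: "monomial_at w (- a) = inverse (monomial_at w a)"
  by (simp add: monomial_at_def power_int_minus prod_inversef[symmetric] o_def)

lemma monomial_at_nonzero: "(\<And>i. w $ i \<noteq> 0) \<Longrightarrow> monomial_at w a \<noteq> 0"
  by (simp add: monomial_at_def)

lemma monomial_at_torus_power: "monomial_at (torus_power j w) a = monomial_at w a ^ j"
  by (simp add: monomial_at_def torus_power_def prod_power_distrib power_int_power power_int_power' mult.commute)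

lemma monomial_at_smult: "monomial_at w (int j *s a) = monomial_at w a ^ j"
  by (simp add: monomial_at_def prod_power_distrib power_int_power power_int_power' mult.commute)

text \<open>Negative exponents make the value at a point with a zero coordinate meaningless (there
\<open>0 powi k = 0\<close> for \<open>k \<noteq> 0\<close>), so multiplicativity holds on \<open>(\<complex>\<^sup>*)\<^sup>d\<close> only.\<close>

lemma laurent_eval_mult:
  assumes "\<And>i. w $ i \<noteq> 0"
  shows "laurent_eval (f * g) w = laurent_eval f w * laurent_eval g w"
proof -
  have "laurent_eval (f * g) w = laurent_eval ((\<Sum>a\<in>Poly_Mapping.keys f. Poly_Mapping.single a (Poly_Mapping.lookup f a)) *
     (\<Sum>b\<in>Poly_Mapping.keys g. Poly_Mapping.single b (Poly_Mapping.lookup g b))) w"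
    using laurent_expansion[of f] laurent_expansion[of g] by simp
  also have "\<dots> = laurent_eval f w * laurent_eval g w"
    by (simp add: sum_product mult_single monomial_at_add[OF assms])
       (simp add: laurent_eval_def sum_product mult_ac)
  finally show ?thesis .
qed

lemma laurent_eval_1 [simp]: "laurent_eval 1 w = 1"
  using laurent_eval_single[of 0 1 w] by (simp del: laurent_eval_single)

lemma laurent_eval_power:
  "(\<And>i. w $ i \<noteq> 0) \<Longrightarrow> laurent_eval (f ^ n) w = laurent_eval f w ^ n"
  by (induction n) (auto simp: laurent_eval_mult)

lemma laurent_eval_prod:
  "(\<And>i. w $ i \<noteq> 0) \<Longrightarrow> laurent_eval (prod F A) w = (\<Prod>x\<in>A. laurent_eval (F x) w)"
  by (induction A rule: infinite_finite_induct) (auto simp: laurent_eval_mult)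

lemma laurent_eval_power_subst:
  "laurent_eval (power_subst j f) w = laurent_eval f (torus_power j w)"
  by (simp add: power_subst_def monomial_at_smult)
     (simp add: laurent_eval_def monomial_at_torus_power)

lemma norm_monomial_at: "w \<in> torus \<Longrightarrow> norm (monomial_at w a) = 1"
  by (simp add: monomial_at_def torus_def norm_power_int flip: prod_norm)

lemma continuous_on_monomial_at:
  "continuous_on torus (\<lambda>w. monomial_at w a)"
  unfolding monomial_at_def
  by (intro continuous_intros) (auto dest: torus_nonzero)

section \<open>Separating a point from a closed power-closed set\<close>

lemma compact_torus: "compact (torus :: (complex ^ 'd::finite) set)"
proof -
  have "closed (torus :: (complex ^ 'd) set)"
    unfolding torus_def sphere_def mem_Collect_eq
    by (intro closed_Collect_all closed_Collect_eq continuous_intros)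
  moreover have "bounded (torus :: (complex ^ 'd) set)"
  proof (rule boundedI)
    fix w :: "complex ^ 'd" assume "w \<in> torus"
    then have "norm (w $ i) = 1" for i by (simp add: torus_def)
    moreover have "norm w \<le> (\<Sum>i\<in>UNIV. norm (w $ i))"
      by (simp add: norm_vec_def L2_set_le_sum)
    ultimately show "norm w \<le> of_nat CARD('d)" by simp
  qed
  ultimately show ?thesis by (simp add: compact_eq_bounded_closed)
qed

lemma torus_power_in_torus: "w \<in> torus \<Longrightarrow> torus_power j w \<in> torus"
  by (simp add: torus_def torus_power_def norm_power)

text \<open>The mean over the powers of a point projects onto the trivial character: a geometric sum with ratio
\<open>u \<noteq> 1\<close> on the unit circle stays bounded.\<close>

lemma mean_of_powers:
  fixes u :: complex
  assumes "norm u = 1"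
  shows "(\<lambda>n. (\<Sum>j<n. u ^ Suc j) / of_nat n) \<longlonglongrightarrow> (if u = 1 then 1 else 0)"
proof (cases "u = 1")
  case True
  have "eventually (\<lambda>n. (\<Sum>j<n. u ^ Suc j) / of_nat n = 1) sequentially"
    using eventually_gt_at_top[of 0] by eventually_elim (simp add: True)
  then show ?thesis using True by (simp add: tendsto_eventually)
next
  case False
  have bound: "norm ((\<Sum>j<n. u ^ Suc j) / of_nat n) \<le> (2 / norm (u - 1)) / real n" for n
  proof -
    have "(\<Sum>j<n. u ^ Suc j) = u * ((u ^ n - 1) / (u - 1))"
      using geometric_sum[OF False, of n] by (simp add: sum_distrib_left[symmetric])
    then have "norm (\<Sum>j<n. u ^ Suc j) = norm (u ^ n - 1) / norm (u - 1)"
      using assms by (simp add: norm_mult norm_divide)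
    also have "\<dots> \<le> 2 / norm (u - 1)"
      using norm_triangle_ineq4[of "u ^ n" 1] assms by (intro divide_right_mono) (auto simp: norm_power)
    finally show ?thesis using divide_right_mono[of _ _ "real n"] by (simp only: norm_divide norm_of_nat)
  qed
  have "(\<lambda>n. (2 / norm (u - 1)) / real n) \<longlonglongrightarrow> 0" by (rule lim_const_over_n)
  then have "(\<lambda>n. (\<Sum>j<n. u ^ Suc j) / of_nat n) \<longlonglongrightarrow> 0"
    by (rule Lim_null_comparison[OF always_eventually, rotated]) (rule allI, rule bound)
  with False show ?thesis by simp
qed

text \<open>The peak function is exponentially small in \<open>N\<close> away from \<open>w\<close>, while the lower bound for its mean decays
only polynomially.\<close>

lemma exists_power_less_inverse_poly:
  fixes q :: real
  assumes "0 \<le> q" "q < 1" "0 < d"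
  shows "\<exists>N. q ^ N < 1 / real (Suc N) ^ d"
proof -
  \<comment> \<open>With \<open>q = r\<^sup>d\<close> the claim is the \<open>d\<close>-th power of \<open>(N+1) r\<^sup>N < 1\<close>.\<close>
  define r where "r = root d q"
  have r: "0 \<le> r" "r < 1" "r ^ d = q"
    using assms by (auto simp: r_def real_root_pow_pos2)
  have "(\<lambda>N. of_nat N * r ^ N + r ^ N) \<longlonglongrightarrow> 0 + 0"
    using r by (intro tendsto_add powser_times_n_limit_0 LIMSEQ_power_zero) auto
  then have "(\<lambda>N. real (Suc N) * r ^ N) \<longlonglongrightarrow> 0"
    by (simp add: algebra_simps)
  then have "eventually (\<lambda>N. real (Suc N) * r ^ N < 1) sequentially"
    by (rule order_tendstoD) simp
  then obtain N where N: "real (Suc N) * r ^ N < 1"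
    by (auto simp: eventually_sequentially)
  have "(real (Suc N) * r ^ N) ^ d < 1"
    using N r assms by (intro power_less_one_iff[THEN iffD2]) auto
  then have "real (Suc N) ^ d * q ^ N < 1"
    by (simp only: power_mult_distrib r(3)[symmetric] power_mult[symmetric] mult.commute)
  then show ?thesis
    by (intro exI[of _ N]) (simp add: field_simps)
qed

text \<open>The exponents of \<open>\<Prod>\<^sub>i (1 + u\<^sub>i)\<^sup>N\<close>, as functions into \<open>{0..N}\<close>.\<close>

definition box :: "nat \<Rightarrow> ('d::finite \<Rightarrow> nat) set" where
  "box N = (\<Pi>\<^sub>E i\<in>UNIV. {..N})"

definition kernel_coeff :: "nat \<Rightarrow> ('d::finite \<Rightarrow> nat) \<Rightarrow> real" where
  "kernel_coeff N g = (\<Prod>i\<in>UNIV. real (N choose g i) / 2 ^ N)"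

definition exponent :: "('d::finite \<Rightarrow> nat) \<Rightarrow> int ^ 'd" where
  "exponent g = (\<chi> i. int (g i))"

text \<open>Its modulus on the torus is at most \<open>1\<close>, with equality only at the identity.\<close>

definition bump :: "complex ^ 'd::finite \<Rightarrow> complex" where
  "bump u = (\<Prod>i\<in>UNIV. (1 + u $ i) / 2)"

lemma finite_box: "finite (box N :: ('d::finite \<Rightarrow> nat) set)"
  and card_box: "card (box N :: ('d::finite \<Rightarrow> nat) set) = Suc N ^ CARD('d)"
  by (auto simp: box_def finite_PiE card_PiE)

lemma kernel_coeff_nonneg: "kernel_coeff N g \<ge> 0"
  by (simp add: kernel_coeff_def prod_nonneg)

lemma bump_power_expansion:
  "bump u ^ N = (\<Sum>g\<in>box N. of_real (kernel_coeff N g) * monomial_at u (exponent g))"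
proof -
  have "((1 + u $ i) / 2) ^ N = (\<Sum>k\<le>N. of_real (real (N choose k) / 2 ^ N) * (u $ i) ^ k)" for i
    using binomial_ring[of "u $ i" 1 N] by (simp add: power_divide sum_divide_distrib add.commute)
  then have "bump u ^ N = (\<Prod>i\<in>UNIV. \<Sum>k\<in>{..N}. of_real (real (N choose k) / 2 ^ N) * (u $ i) ^ k)"
    by (simp only: bump_def prod_power_distrib)
  also have "\<dots> = (\<Sum>g\<in>box N. \<Prod>i\<in>UNIV. of_real (real (N choose g i) / 2 ^ N) * (u $ i) ^ g i)"
    unfolding box_def by (rule prod_sum_PiE) auto
  also have "\<dots> = (\<Sum>g\<in>box N. of_real (kernel_coeff N g) * monomial_at u (exponent g))"
    by (simp only: prod.distrib of_real_prod kernel_coeff_def monomial_at_def exponent_def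
        vec_lambda_beta power_int_of_nat)
  finally show ?thesis .
qed

lemma sum_kernel_coeff: "(\<Sum>g\<in>box N. kernel_coeff N (g :: 'd::finite \<Rightarrow> nat)) = 1"
proof -
  let ?one = "(\<chi> i. 1) :: complex ^ 'd"
  have "complex_of_real (\<Sum>g\<in>box N. kernel_coeff N (g :: 'd \<Rightarrow> nat)) = bump ?one ^ N"
    by (simp add: bump_power_expansion monomial_at_def)
  also have "\<dots> = 1" by (simp add: bump_def)
  finally show ?thesis by (simp only: of_real_eq_1_iff)
qed

text \<open>The sum is the coefficient of the trivial character in \<open>\<bar>bump\<bar>\<^sup>2\<^sup>N\<close>. By Cauchy-Schwarz it is
at least the reciprocal of the number of exponents, as the coefficients sum to \<open>1\<close>.\<close>

lemma sum_kernel_coeff_square: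
  "1 / real (Suc N) ^ CARD('d) \<le> (\<Sum>g\<in>box N. kernel_coeff N (g :: 'd::finite \<Rightarrow> nat) ^ 2)"
proof -
  have "(\<Sum>g\<in>box N. kernel_coeff N (g :: 'd \<Rightarrow> nat)) ^ 2
      \<le> (\<Sum>g\<in>box N. kernel_coeff N (g :: 'd \<Rightarrow> nat) ^ 2) * real (card (box N :: ('d \<Rightarrow> nat) set))"
    by (rule sum_squared_le_sum_of_squares)
  then show ?thesis
    by (simp add: sum_kernel_coeff card_box field_simps)
qed

text \<open>On the torus conjugation inverts monomials, so the squared modulus is again a trigonometric
polynomial, with nonnegative coefficients.\<close>

lemma norm_bump_power_expansion:
  fixes u :: "complex ^ 'd::finite"
  assumes "u \<in> torus"
  shows "of_real (norm (bump u ^ N) ^ 2) =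
    (\<Sum>g\<in>box N. \<Sum>h\<in>box N. of_real (kernel_coeff N g * kernel_coeff N h) *
        monomial_at u (exponent g - exponent h))"
proof -
  have cnj: "cnj (monomial_at u a) = monomial_at u (- a)" for a
    using norm_monomial_at[OF assms, of a] complex_div_cnj[of 1 "monomial_at u a"]
    by (simp add: monomial_at_uminus divide_inverse)
  have nz: "u $ i \<noteq> 0" for i using assms by (rule torus_nonzero)
  have "of_real (norm (bump u ^ N) ^ 2) = bump u ^ N * cnj (bump u ^ N)"
    by (simp only: complex_norm_square)
  then show ?thesis
    by (simp add: bump_power_expansion sum_product cnj mult_ac
        monomial_at_add[OF nz, of _ "- _", simplified])
qed

lemma norm_bump_factor:
  assumes "norm z = 1" "norm w = 1"
  shows "norm ((1 + z / w) / 2 :: complex) \<le> 1" "z \<noteq> w \<Longrightarrow> norm ((1 + z / w) / 2 :: complex) < 1"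
proof -
  show le: "norm ((1 + z / w) / 2 :: complex) \<le> 1"
    using norm_triangle_ineq[of 1 "z / w"] assms by (simp add: norm_divide)
  assume "z \<noteq> w"
  show "norm ((1 + z / w) / 2 :: complex) < 1"
  proof (rule ccontr)
    assume "\<not> ?thesis"
    with le have "norm (1 + z / w) = norm (1::complex) + norm (z / w)"
      using assms by (simp add: norm_divide)
    then have "norm (1::complex) *\<^sub>R (z / w) = norm (z / w) *\<^sub>R (1::complex)"
      by (simp only: norm_triangle_eq)
    then have "z / w = 1" using assms by (simp add: norm_divide)
    with \<open>z \<noteq> w\<close> assms show False by (auto simp: field_simps)
  qed
qed

lemma bump_less_1:
  fixes z w :: "complex ^ 'd::finite"
  assumes "z \<in> torus" "w \<in> torus" "z \<noteq> w"
  shows "norm (bump (\<chi> i. z $ i / w $ i)) < 1"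
proof -
  from assms(3) obtain k where k: "z $ k \<noteq> w $ k" by (auto simp: vec_eq_iff)
  have n: "norm (z $ i) = 1" "norm (w $ i) = 1" for i
    using assms by (auto simp: torus_def)
  have "norm (bump (\<chi> i. z $ i / w $ i)) = (\<Prod>i\<in>UNIV. norm ((1 + z $ i / w $ i) / 2))"
    by (simp only: bump_def prod_norm vec_lambda_beta)
  also have "\<dots> = norm ((1 + z $ k / w $ k) / 2) * (\<Prod>i\<in>UNIV - {k}. norm ((1 + z $ i / w $ i) / 2))"
    by (rule prod.remove) auto
  also have "\<dots> \<le> norm ((1 + z $ k / w $ k) / 2) * 1"
    using norm_bump_factor(1)[OF n] by (intro mult_left_mono prod_le_1) auto
  also have "\<dots> < 1" using norm_bump_factor(2)[OF n k] by simp
  finally show ?thesis .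
qed

text \<open>The translate of the bump that peaks at \<open>w\<close> attains its maximum over the compact set \<open>Z\<close>.\<close>

lemma bump_bounded_away:
  fixes Z :: "(complex ^ 'd::finite) set"
  assumes "compact Z" "Z \<subseteq> torus" "w \<in> torus" "w \<notin> Z"
  shows "\<exists>q. 0 \<le> q \<and> q < 1 \<and> (\<forall>z\<in>Z. norm (bump (\<chi> i. z $ i / w $ i)) ^ 2 \<le> q)"
proof (cases "Z = {}")
  case True then show ?thesis by (intro exI[of _ 0]) auto
next
  case False
  have "continuous_on Z (\<lambda>z. norm (bump (\<chi> i. z $ i / w $ i)) ^ 2)"
    unfolding bump_def vec_lambda_beta using torus_nonzero[OF assms(3)]
    by (intro continuous_intros) simp_all
  from continuous_attains_sup[OF assms(1) False this] obtain z0 where z0: "z0 \<in> Z"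
    "\<And>z. z \<in> Z \<Longrightarrow> norm (bump (\<chi> i. z $ i / w $ i)) ^ 2 \<le> norm (bump (\<chi> i. z0 $ i / w $ i)) ^ 2"
    by (elim bexE) blast
  have "norm (bump (\<chi> i. z0 $ i / w $ i)) ^ 2 < 1"
    using bump_less_1[of z0 w] z0(1) assms unfolding abs_square_less_1 by auto
  with z0 show ?thesis by (intro exI[of _ "norm (bump (\<chi> i. z0 $ i / w $ i)) ^ 2"]) auto
qed

lemma closed_power_setsD:
  assumes "Z \<in> closed_power_sets"
  shows "Z \<subseteq> torus" "compact Z" "\<And>z j. z \<in> Z \<Longrightarrow> torus_power (Suc j) z \<in> Z"
proof -
  have Z: "closedin (top_of_set torus) Z" "\<forall>j\<ge>1. \<forall>w\<in>Z. torus_power j w \<in> Z"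
    using assms by (simp_all add: closed_power_sets_def)
  show "Z \<subseteq> torus" using closedin_imp_subset[OF Z(1)] .
  show "compact Z" using closedin_compact[OF compact_torus Z(1)] .
  show "torus_power (Suc j) z \<in> Z" if "z \<in> Z" for z j using Z(2) that by simp
qed

text \<open>Averaging over the powers of \<open>z\<close> keeps the values of the peak function below \<open>q\<^sup>N\<close>, because \<open>Z\<close> contains
these powers. If every exponent \<open>a\<close> with \<open>z\<^sup>a = 1\<close> also had \<open>w\<^sup>a = 1\<close>, the mean would be a sum of
nonnegative coefficients that includes the diagonal ones, too large for \<open>q\<^sup>N\<close>. The set \<open>F\<close> does not depend
on \<open>z\<close>; this uniformity yields a single polynomial for all of \<open>Z\<close>.\<close>

lemma separating_exponents:
  fixes Z :: "(complex ^ 'd::finite) set"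
  assumes Z: "Z \<in> closed_power_sets" and w: "w \<in> torus" "w \<notin> Z"
  shows "\<exists>F. finite F \<and> (\<forall>z\<in>Z. \<exists>a\<in>F. monomial_at z a = 1 \<and> monomial_at w a \<noteq> 1)"
proof -
  note Z' = closed_power_setsD[OF Z]
  obtain q where q: "0 \<le> q" "q < 1"
    "\<And>z. z \<in> Z \<Longrightarrow> norm (bump (\<chi> i. z $ i / w $ i)) ^ 2 \<le> q"
    using bump_bounded_away[OF Z'(2,1) w] by blast
  obtain N where N: "q ^ N < 1 / real (Suc N) ^ CARD('d)"
    using exists_power_less_inverse_poly[OF q(1,2), of "CARD('d)"] by auto
  define F :: "(int ^ 'd) set" where "F = (\<lambda>(g, h). exponent g - exponent h) ` (box N \<times> box N)"
  have "\<exists>a\<in>F. monomial_at z a = 1 \<and> monomial_at w a \<noteq> 1" if z: "z \<in> Z" for z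
  proof (rule ccontr)
    assume neg: "\<not> ?thesis"
    have zt: "z \<in> torus" using z Z'(1) by auto
    define u where "u j = (\<chi> i. torus_power (Suc j) z $ i / w $ i)" for j
    define c where "c g h = kernel_coeff N g * kernel_coeff N h" for g h :: "'d \<Rightarrow> nat"
    have u_torus: "u j \<in> torus" for j
      using zt w(1) by (auto simp: u_def torus_def torus_power_def norm_divide norm_power norm_mult)
    have u_mono: "monomial_at (u j) a = monomial_at z a ^ Suc j / monomial_at w a" for j a
    proof -
      have "monomial_at (u j) a = monomial_at (torus_power (Suc j) z) a / monomial_at w a"
        by (simp add: u_def monomial_at_def power_int_divide_distrib prod_dividef)
      then show ?thesis by (simp only: monomial_at_torus_power)
    qed
    define S where "S = (\<Sum>g\<in>box N. \<Sum>h\<in>box N. c g h *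
        (if monomial_at z (exponent g - exponent h) = 1 then 1 else 0))"
    \<comment> \<open>The mean of the peak function over the powers of \<open>z\<close>, expanded into means of characters.\<close>
    have mean: "(\<Sum>j<n. of_real (norm (bump (u j) ^ N) ^ 2)) / of_nat n =
      (\<Sum>g\<in>box N. \<Sum>h\<in>box N. of_real (c g h) / monomial_at w (exponent g - exponent h) *
        ((\<Sum>j<n. monomial_at z (exponent g - exponent h) ^ Suc j) / of_nat n))" for n
    proof -
      have "(\<Sum>j<n. of_real (norm (bump (u j) ^ N) ^ 2)) =
        (\<Sum>j<n. \<Sum>g\<in>box N. \<Sum>h\<in>box N. of_real (c g h) / monomial_at w (exponent g - exponent h) *
           monomial_at z (exponent g - exponent h) ^ Suc j)"
        by (simp only: norm_bump_power_expansion[OF u_torus] u_mono c_def times_divide_eq_right times_divide_eq_left)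
      also have "\<dots> = (\<Sum>g\<in>box N. \<Sum>h\<in>box N. \<Sum>j<n. of_real (c g h) / monomial_at w (exponent g - exponent h) *
           monomial_at z (exponent g - exponent h) ^ Suc j)"
        by (subst sum.swap, rule sum.cong[OF refl], rule sum.swap)
      finally show ?thesis
        by (simp only: sum_divide_distrib sum_distrib_left times_divide_eq_right)
    qed
    have "(\<lambda>n. (\<Sum>j<n. of_real (norm (bump (u j) ^ N) ^ 2)) / of_nat n) \<longlonglongrightarrow>
      (\<Sum>g\<in>box N. \<Sum>h\<in>box N. of_real (c g h) / monomial_at w (exponent g - exponent h) *
        (if monomial_at z (exponent g - exponent h) = 1 then 1 else 0))"
      unfolding mean by (intro tendsto_sum tendsto_mult tendsto_const mean_of_powers norm_monomial_at zt)
    also have "(\<Sum>g\<in>box N. \<Sum>h\<in>box N. of_real (c g h) / monomial_at w (exponent g - exponent h) *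
        (if monomial_at z (exponent g - exponent h) = 1 then 1 else 0)) = complex_of_real S"
    proof -
      have "of_real (c g h) / monomial_at w (exponent g - exponent h) *
        (if monomial_at z (exponent g - exponent h) = 1 then 1 else 0) =
        complex_of_real (c g h * (if monomial_at z (exponent g - exponent h) = 1 then 1 else 0))"
        if "g \<in> box N" "h \<in> box N" for g h
      proof -
        have "exponent g - exponent h \<in> F"
          unfolding F_def using that by (intro image_eqI[of _ _ "(g, h)"]) auto
        with neg have "monomial_at z (exponent g - exponent h) = 1 \<Longrightarrow> monomial_at w (exponent g - exponent h) = 1"
          by blast
        then show ?thesis by simp
      qed
      then show ?thesis unfolding S_def of_real_sum by (intro sum.cong refl)
    qed
    finally have "(\<lambda>n. complex_of_real ((\<Sum>j<n. norm (bump (u j) ^ N) ^ 2) / real n)) \<longlonglongrightarrow> of_real S"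
      by simp
    then have lim: "(\<lambda>n. (\<Sum>j<n. norm (bump (u j) ^ N) ^ 2) / real n) \<longlonglongrightarrow> S"
      by (simp only: tendsto_of_real_iff)
    have bound: "norm (bump (u j) ^ N) ^ 2 \<le> q ^ N" for j
    proof -
      have "norm (bump (u j)) ^ 2 \<le> q"
        unfolding u_def using Z'(3)[OF z] by (rule q(3))
      then have "(norm (bump (u j)) ^ 2) ^ N \<le> q ^ N" by (intro power_mono) auto
      then show ?thesis by (simp add: norm_power power_mult[symmetric] mult.commute)
    qed
    have "S \<le> q ^ N"
    proof (rule tendsto_upperbound[OF lim])
      show "eventually (\<lambda>n. (\<Sum>j<n. norm (bump (u j) ^ N) ^ 2) / real n \<le> q ^ N) sequentially"
        using eventually_gt_at_top[of 0]
      proof eventually_elim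
        case (elim n)
        have "(\<Sum>j<n. norm (bump (u j) ^ N) ^ 2) \<le> (\<Sum>j<n. q ^ N)"
          by (intro sum_mono bound)
        with elim show ?case by (simp add: field_simps)
      qed
    qed auto
    moreover have "(\<Sum>g\<in>box N. kernel_coeff N (g :: 'd \<Rightarrow> nat) ^ 2) \<le> S"
      unfolding S_def
    proof (rule sum_mono)
      fix g :: "'d \<Rightarrow> nat" assume g: "g \<in> box N"
      have "kernel_coeff N g ^ 2 = c g g * (if monomial_at z (exponent g - exponent g) = 1 then 1 else 0)"
        by (simp add: c_def power2_eq_square)
      also have "\<dots> \<le> (\<Sum>h\<in>box N. c g h * (if monomial_at z (exponent g - exponent h) = 1 then 1 else 0))"
        using g by (intro member_le_sum finite_box) (auto simp: c_def kernel_coeff_nonneg)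
      finally show "kernel_coeff N g ^ 2 \<le> \<dots>" .
    qed
    ultimately show False
      using N sum_kernel_coeff_square[where 'd = 'd, of N] by linarith
  qed
  moreover have "finite F" by (simp add: F_def finite_box)
  ultimately show ?thesis by blast
qed

section \<open>Finite unions of closed subgroups\<close>

definition additive_subgroup_set :: "'a::ab_group_add set \<Rightarrow> bool" where
  "additive_subgroup_set A \<longleftrightarrow> 0 \<in> A \<and> (\<forall>a\<in>A. \<forall>b\<in>A. a - b \<in> A)"

lemma additive_subgroup_setD:
  assumes "additive_subgroup_set A"
  shows "0 \<in> A" "\<And>a b. a \<in> A \<Longrightarrow> b \<in> A \<Longrightarrow> a - b \<in> A" "\<And>a. a \<in> A \<Longrightarrow> - a \<in> A"
    "\<And>a b. a \<in> A \<Longrightarrow> b \<in> A \<Longrightarrow> a + b \<in> A"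
proof -
  show 0: "0 \<in> A" and minus: "\<And>a b. a \<in> A \<Longrightarrow> b \<in> A \<Longrightarrow> a - b \<in> A"
    using assms by (auto simp: additive_subgroup_set_def)
  show neg: "- a \<in> A" if "a \<in> A" for a using minus[OF 0 that] by simp
  show "a + b \<in> A" if "a \<in> A" "b \<in> A" for a b using minus[OF that(1) neg[OF that(2)]] by simp
qed

lemma int_subgroup_multiple:
  fixes A :: "int set"
  assumes "additive_subgroup_set A" "g \<in> A"
  shows "g * k \<in> A"
proof (induction k rule: int_induct[of _ 0])
  case base then show ?case using additive_subgroup_setD(1)[OF assms(1)] by simp
next
  case (step1 k) then show ?case
    using additive_subgroup_setD(4)[OF assms(1) _ assms(2), of "g * k"] by (simp add: algebra_simps)
next
  case (step2 k) then show ?case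
    using additive_subgroup_setD(2)[OF assms(1) _ assms(2), of "g * k"] by (simp add: algebra_simps)
qed

text \<open>The least positive integer in the union of the chain generates the union, and it already lies in some
member.\<close>

lemma int_subgroup_chain_stabilizes:
  fixes A :: "nat \<Rightarrow> int set"
  assumes sub: "\<And>n. additive_subgroup_set (A n)" and mono: "mono A"
  shows "\<exists>N. \<forall>n\<ge>N. A n = A N"
proof (cases "\<exists>n. \<exists>x\<in>A n. x > 0")
  case False
  have "A n = {0}" for n
  proof -
    have "x = 0" if "x \<in> A n" for x
      using False that additive_subgroup_setD(3)[OF sub that] by (metis linorder_neqE neg_0_less_iff_less)
    then show ?thesis using additive_subgroup_setD(1)[OF sub] by auto
  qed
  then show ?thesis by auto
next
  case True
  define P where "P k \<longleftrightarrow> k > 0 \<and> (\<exists>n. int k \<in> A n)" for k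
  from True obtain n x where "x \<in> A n" "x > 0" by auto
  then have "P (nat x)" by (auto simp: P_def)
  define g where "g = (LEAST k. P k)"
  have "P g" unfolding g_def using \<open>P (nat x)\<close> by (rule LeastI)
  then obtain N where g: "g > 0" "int g \<in> A N" by (auto simp: P_def)
  have "A n = A N" if "n \<ge> N" for n
  proof
    show "A N \<subseteq> A n" using mono that by (rule monoD)
    show "A n \<subseteq> A N"
    proof
      fix x assume x: "x \<in> A n"
      have "int g \<in> A n" using \<open>A N \<subseteq> A n\<close> g by auto
      then have "x - int g * (x div int g) \<in> A n"
        by (intro additive_subgroup_setD(2)[OF sub] x int_subgroup_multiple[OF sub])
      then have mem: "x mod int g \<in> A n" by (simp add: minus_mult_div_eq_mod)
      have "x mod int g = 0"
      proof (rule ccontr)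
        assume "x mod int g \<noteq> 0"
        moreover have "x mod int g \<ge> 0" "x mod int g < int g" using g by auto
        ultimately have "P (nat (x mod int g))" using mem by (auto simp: P_def)
        then have "g \<le> nat (x mod int g)" unfolding g_def by (rule Least_le)
        with \<open>x mod int g < int g\<close> g show False by linarith
      qed
      then have "x = int g * (x div int g)" by (metis mult_div_mod_eq add.right_neutral)
      then show "x \<in> A N" using int_subgroup_multiple[OF sub g(2), of "x div int g"] by simp
    qed
  qed
  then show ?thesis by blast
qed

text \<open>Induction on the set of coordinates that may be nonzero: a subgroup is determined, inside a larger one,
by its projection to one coordinate and the kernel of that projection, and both chains stabilize.\<close>

lemma supported_subgroup_chain_stabilizes:
  fixes A :: "nat \<Rightarrow> (int ^ 'd::finite) set"
  assumes "finite S" "\<And>n. additive_subgroup_set (A n)" "mono A"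
    "\<And>n a i. a \<in> A n \<Longrightarrow> i \<notin> S \<Longrightarrow> a $ i = 0"
  shows "\<exists>N. \<forall>n\<ge>N. A n = A N"
  using assms
proof (induction S arbitrary: A rule: finite_induct)
  case empty
  have "A n = {0}" for n
    using empty.prems(3)[of _ n] additive_subgroup_setD(1)[OF empty.prems(1), of n] by (auto simp: vec_eq_iff)
  then show ?case by auto
next
  case (insert s S)
  note sub = additive_subgroup_setD[OF insert.prems(1)]
  have mono: "A m \<subseteq> A n" if "m \<le> n" for m n using insert.prems(2) that by (rule monoD)
  have "\<exists>N. \<forall>n\<ge>N. {a\<in>A n. a $ s = 0} = {a\<in>A N. a $ s = 0}"
  proof (rule insert.IH)
    show "additive_subgroup_set {a \<in> A n. a $ s = 0}" for n
      using additive_subgroup_setD[OF insert.prems(1)[of n]] by (auto simp: additive_subgroup_set_def)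
    show "mono (\<lambda>n. {a \<in> A n. a $ s = 0})"
      using mono by (auto intro!: monoI)
    show "a $ i = 0" if "a \<in> {a \<in> A n. a $ s = 0}" "i \<notin> S" for n a i
      using that insert.prems(3)[of a n i] by (cases "i = s") auto
  qed
  then obtain N1 where N1: "\<And>n. n \<ge> N1 \<Longrightarrow> {a\<in>A n. a $ s = 0} = {a\<in>A N1. a $ s = 0}" by blast
  have "\<exists>N. \<forall>n\<ge>N. (\<lambda>a. a $ s) ` A n = (\<lambda>a. a $ s) ` A N"
  proof (rule int_subgroup_chain_stabilizes)
    show "additive_subgroup_set ((\<lambda>a. a $ s) ` A n)" for n
      unfolding additive_subgroup_set_def
    proof (intro conjI ballI)
      show "0 \<in> (\<lambda>a. a $ s) ` A n" using sub(1)[of n] by (intro image_eqI[of _ _ 0]) auto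
      fix x y assume "x \<in> (\<lambda>a. a $ s) ` A n" "y \<in> (\<lambda>a. a $ s) ` A n"
      then obtain a b where "a \<in> A n" "b \<in> A n" "x = a $ s" "y = b $ s" by auto
      then show "x - y \<in> (\<lambda>a. a $ s) ` A n"
        using sub(2)[of a n b] by (intro image_eqI[of _ _ "a - b"]) auto
    qed
    show "mono (\<lambda>n. (\<lambda>a. a $ s) ` A n)"
      using mono by (auto intro!: monoI)
  qed
  then obtain N2 where N2: "\<And>n. n \<ge> N2 \<Longrightarrow> (\<lambda>a. a $ s) ` A n = (\<lambda>a. a $ s) ` A N2" by blast
  have "A n = A (max N1 N2)" if n: "n \<ge> max N1 N2" for n
  proof
    show "A (max N1 N2) \<subseteq> A n" using mono n .
    show "A n \<subseteq> A (max N1 N2)"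
    proof
      fix a assume a: "a \<in> A n"
      have "a $ s \<in> (\<lambda>a. a $ s) ` A N2" using a n N2[of n] by auto
      then obtain b where b: "b \<in> A N2" "b $ s = a $ s" by auto
      have "b \<in> A n" using b(1) mono[of N2 n] n by auto
      with a have "a - b \<in> A n" by (rule sub(2))
      then have "a - b \<in> {a\<in>A n. a $ s = 0}" using b(2) by simp
      then have "a - b \<in> A N1" using N1[of n] n by auto
      then have "a - b \<in> A (max N1 N2)" using mono[of N1 "max N1 N2"] by auto
      moreover have "b \<in> A (max N1 N2)" using b(1) mono[of N2 "max N1 N2"] by auto
      ultimately have "(a - b) + b \<in> A (max N1 N2)" by (rule sub(4))
      then show "a \<in> A (max N1 N2)" by simp
    qed
  qed
  then show ?case by blast
qed

lemma wf_exponent_subgroups: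
  "wf {(B, A). additive_subgroup_set A \<and> additive_subgroup_set B \<and> A \<subset> (B :: (int ^ 'd::finite) set)}"
  unfolding wf_iff_no_infinite_down_chain
proof
  assume "\<exists>A. \<forall>n. (A (Suc n), A n) \<in>
    {(B, A). additive_subgroup_set A \<and> additive_subgroup_set B \<and> A \<subset> (B :: (int ^ 'd) set)}"
  then obtain A :: "nat \<Rightarrow> (int ^ 'd) set" where
    chain: "\<forall>n. (A (Suc n), A n) \<in>
    {(B, A). additive_subgroup_set A \<and> additive_subgroup_set B \<and> A \<subset> (B :: (int ^ 'd) set)}" ..
  then have A: "additive_subgroup_set (A n)" "A n \<subset> A (Suc n)" for n
    by (simp_all only: mem_Collect_eq case_prod_conv)
  have "mono A" using A(2) by (intro incseq_SucI psubset_imp_subset)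
  with A(1) have "\<exists>N. \<forall>n\<ge>N. A n = A N"
    by (intro supported_subgroup_chain_stabilizes[of UNIV]) auto
  then obtain N where "\<forall>n\<ge>N. A n = A N" ..
  then have "A (Suc N) = A N" by (metis le_SucI order_refl)
  with A(2)[of N] show False by simp
qed

definition common_kernel :: "(int ^ 'd::finite) set \<Rightarrow> (complex ^ 'd) set" where
  "common_kernel A = {z\<in>torus. \<forall>a\<in>A. monomial_at z a = 1}"

definition annihilator :: "(complex ^ 'd::finite) set \<Rightarrow> (int ^ 'd) set" where
  "annihilator W = {a. \<forall>z\<in>W. monomial_at z a = 1}"

lemma additive_subgroup_annihilator:
  assumes "W \<subseteq> torus"
  shows "additive_subgroup_set (annihilator W)"
proof -
  have "monomial_at z (a - b) = monomial_at z a / monomial_at z b" if "z \<in> W" for z a b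
    using that assms torus_nonzero by (intro monomial_at_diff) blast
  then show ?thesis by (simp add: additive_subgroup_set_def annihilator_def)
qed

lemma common_kernel_annihilator_common_kernel:
  "common_kernel (annihilator (common_kernel A)) = common_kernel A"
  by (auto simp: common_kernel_def annihilator_def)

lemma group_torus_group: "group (torus_group :: (complex ^ 'd::finite) monoid)"
proof (rule groupI)
  fix w :: "complex ^ 'd" assume "w \<in> carrier torus_group"
  then have w: "w \<in> torus" by (simp add: torus_group_def)
  show "\<exists>v\<in>carrier torus_group. v \<otimes>\<^bsub>torus_group\<^esub> w = \<one>\<^bsub>torus_group\<^esub>"
    using w torus_nonzero[OF w]
    by (intro bexI[of _ "\<chi> i. inverse (w $ i)"]) (auto simp: torus_group_def torus_def norm_inverse vec_eq_iff)
qed (auto simp: torus_group_def torus_def norm_mult vec_eq_iff mult_ac)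

lemma inv_torus_group:
  assumes "w \<in> torus"
  shows "inv\<^bsub>torus_group\<^esub> w = (\<chi> i. inverse (w $ i))"
  using assms torus_nonzero[OF assms]
  by (intro group.inv_equality[OF group_torus_group])
     (auto simp: torus_group_def torus_def norm_inverse vec_eq_iff)

lemma monomial_at_inverse: "monomial_at (\<chi> i. inverse (w $ i)) a = inverse (monomial_at w a)"
  by (simp add: monomial_at_def power_int_inverse prod_inversef[symmetric] o_def)

lemma subgroup_common_kernel: "subgroup (common_kernel A) torus_group"
proof (rule subgroup.intro)
  show "common_kernel A \<subseteq> carrier torus_group" by (auto simp: common_kernel_def torus_group_def)
  show "\<one>\<^bsub>torus_group\<^esub> \<in> common_kernel A"
    by (auto simp: common_kernel_def torus_group_def torus_def monomial_at_def)
  fix v assume v: "v \<in> common_kernel A"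
  then have "v \<in> torus" by (simp add: common_kernel_def)
  then show "inv\<^bsub>torus_group\<^esub> v \<in> common_kernel A"
    using v by (simp add: inv_torus_group common_kernel_def torus_def norm_inverse monomial_at_inverse)
  fix w assume "w \<in> common_kernel A"
  with v show "v \<otimes>\<^bsub>torus_group\<^esub> w \<in> common_kernel A"
    by (auto simp: common_kernel_def torus_def torus_group_def norm_mult monomial_at_def
        power_int_mult_distrib prod.distrib)
qed

lemma closedin_common_kernel: "closedin (top_of_set torus) (common_kernel A)"
proof (cases "A = {}")
  case False
  have "closedin (top_of_set torus) (\<Inter>a\<in>A. {z\<in>torus. monomial_at z a = 1})"
    using False by (intro closedin_INT continuous_closedin_preimage_constant continuous_on_monomial_at) auto
  also have "(\<Inter>a\<in>A. {z\<in>torus. monomial_at z a = 1}) = common_kernel A"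
    using False by (auto simp: common_kernel_def)
  finally show ?thesis .
qed (simp add: common_kernel_def)

text \<open>Noetherian induction on \<open>A\<close>. A point \<open>w\<close> of the common kernel outside \<open>Z\<close> has finitely many separating
exponents. Those with \<open>w\<^sup>a \<noteq> 1\<close> are not in \<open>A\<close>, and every \<open>z \<in> Z\<close> satisfies \<open>z\<^sup>a = 1\<close> for one of them, so they
split \<open>Z \<inter> common_kernel A\<close> into pieces with strictly larger annihilators.\<close>

lemma closed_power_set_Int_common_kernel:
  fixes Z :: "(complex ^ 'd::finite) set"
  assumes Z: "Z \<in> closed_power_sets" and "additive_subgroup_set A"
  shows "\<exists>\<H>. finite \<H> \<and> (\<forall>H\<in>\<H>. subgroup H torus_group \<and> closedin (top_of_set torus) H) \<and>
           \<Union>\<H> = Z \<inter> common_kernel A"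
  using wf_exponent_subgroups assms(2)
proof (induction A rule: wf_induct_rule)
  case (less A)
  show ?case
  proof (cases "common_kernel A \<subseteq> Z")
    case True
    then show ?thesis
      using subgroup_common_kernel[of A] closedin_common_kernel[of A] by (intro exI[of _ "{common_kernel A}"]) auto
  next
    case False
    then obtain w where w: "w \<in> common_kernel A" "w \<notin> Z" by auto
    then have "w \<in> torus" by (simp add: common_kernel_def)
    from separating_exponents[OF Z this w(2)] obtain F where F: "finite F"
      "\<And>z. z \<in> Z \<Longrightarrow> \<exists>a\<in>F. monomial_at z a = 1 \<and> monomial_at w a \<noteq> 1" by blast
    define F' where "F' = {a\<in>F. monomial_at w a \<noteq> 1}"
    have "\<exists>\<H>. finite \<H> \<and> (\<forall>H\<in>\<H>. subgroup H torus_group \<and> closedin (top_of_set torus) H) \<and>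
           \<Union>\<H> = Z \<inter> common_kernel (insert a A)" if a: "a \<in> F'" for a
    proof -
      \<comment> \<open>The annihilator is a subgroup containing \<open>A\<close> and \<open>a\<close> with the same common kernel.\<close>
      let ?B = "annihilator (common_kernel (insert a A))"
      have "A \<subset> ?B"
        using a w(1) by (auto simp: F'_def annihilator_def common_kernel_def)
      moreover have "additive_subgroup_set ?B"
        by (rule additive_subgroup_annihilator) (auto simp: common_kernel_def)
      ultimately show ?thesis
        using less.IH[of ?B] less.prems by (simp add: common_kernel_annihilator_common_kernel)
    qed
    then obtain \<H> where \<H>: "\<And>a. a \<in> F' \<Longrightarrow> finite (\<H> a)"
      "\<And>a H. a \<in> F' \<Longrightarrow> H \<in> \<H> a \<Longrightarrow> subgroup H torus_group \<and> closedin (top_of_set torus) H"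
      "\<And>a. a \<in> F' \<Longrightarrow> \<Union>(\<H> a) = Z \<inter> common_kernel (insert a A)" by metis
    have "\<Union>(\<Union>a\<in>F'. \<H> a) = (\<Union>a\<in>F'. \<Union>(\<H> a))" by blast
    also have "\<dots> = (\<Union>a\<in>F'. Z \<inter> common_kernel (insert a A))" using \<H>(3) by simp
    also have "\<dots> = Z \<inter> common_kernel A"
    proof (intro equalityI subsetI)
      fix z assume z: "z \<in> Z \<inter> common_kernel A"
      then obtain a where "a \<in> F'" "monomial_at z a = 1" using F(2)[of z] by (auto simp: F'_def)
      with z show "z \<in> (\<Union>a\<in>F'. Z \<inter> common_kernel (insert a A))" by (auto simp: common_kernel_def)
    qed (auto simp: common_kernel_def)
    finally show ?thesis
      using \<H>(1,2) F(1) by (intro exI[of _ "\<Union>a\<in>F'. \<H> a"]) (auto simp: F'_def)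
  qed
qed

lemma torus_power_in_subgroup:
  assumes "subgroup H torus_group" "w \<in> H"
  shows "torus_power j w \<in> H"
proof (induction j)
  case 0
  then show ?case using subgroup.one_closed[OF assms(1)] by (simp add: torus_power_def torus_group_def)
next
  case (Suc j)
  then show ?case using subgroup.m_closed[OF assms(1) assms(2) Suc] by (simp add: torus_power_def torus_group_def)
qed

lemma closed_power_sets_eq:
  "(closed_power_sets :: (complex ^ 'd::finite) set set) =
     {\<Union>\<H> | \<H>. finite \<H> \<and> (\<forall>H\<in>\<H>. subgroup H torus_group \<and> closedin (top_of_set torus) H)}"
proof (intro equalityI subsetI)
  fix Z :: "(complex ^ 'd) set" assume Z: "Z \<in> closed_power_sets"
  have "additive_subgroup_set {0 :: int ^ 'd}" by (simp add: additive_subgroup_set_def)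
  from closed_power_set_Int_common_kernel[OF Z this]
  obtain \<H> where \<H>: "finite \<H>" "\<forall>H\<in>\<H>. subgroup H torus_group \<and> closedin (top_of_set torus) H"
    "\<Union>\<H> = Z \<inter> common_kernel {0 :: int ^ 'd}" by blast
  moreover have "Z \<inter> common_kernel {0 :: int ^ 'd} = Z"
    using closed_power_setsD(1)[OF Z] by (auto simp: common_kernel_def)
  ultimately show "Z \<in> {\<Union>\<H> | \<H>. finite \<H> \<and> (\<forall>H\<in>\<H>. subgroup H torus_group \<and> closedin (top_of_set torus) H)}"
    by auto
next
  fix Z :: "(complex ^ 'd) set"
  assume "Z \<in> {\<Union>\<H> | \<H>. finite \<H> \<and> (\<forall>H\<in>\<H>. subgroup H torus_group \<and> closedin (top_of_set torus) H)}"
  then obtain \<H> where \<H>: "Z = \<Union>\<H>" "finite \<H>" "\<And>H. H \<in> \<H> \<Longrightarrow> subgroup H torus_group"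
    "\<And>H. H \<in> \<H> \<Longrightarrow> closedin (top_of_set torus) H" by blast
  have "closedin (top_of_set torus) Z" unfolding \<H>(1) using \<H>(2,4) by (rule closedin_Union)
  moreover have "torus_power j w \<in> Z" if "w \<in> Z" for j w
  proof -
    from that obtain H where "H \<in> \<H>" "w \<in> H" unfolding \<H>(1) by (rule UnionE)
    then show ?thesis unfolding \<H>(1) using torus_power_in_subgroup[OF \<H>(3)] by (intro UnionI)
  qed
  ultimately show "Z \<in> closed_power_sets" by (simp add: closed_power_sets_def)
qed

section \<open>The Nullstellensatz for Laurent polynomials over the complex numbers\<close>

text \<open>The ideals of a commutative ring in type class form, for calculations outside the record-based rings.\<close>

definition ring_ideal :: "'a::comm_ring_1 set \<Rightarrow> bool" where
  "ring_ideal I \<longleftrightarrow> 0 \<in> I \<and> (\<forall>a\<in>I. \<forall>b\<in>I. a + b \<in> I) \<and> (\<forall>a\<in>I. \<forall>r. r * a \<in> I)"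

lemma ring_idealD:
  assumes "ring_ideal I"
  shows "0 \<in> I" "\<And>a b. a \<in> I \<Longrightarrow> b \<in> I \<Longrightarrow> a + b \<in> I" "\<And>a r. a \<in> I \<Longrightarrow> r * a \<in> I"
    "\<And>a b. a \<in> I \<Longrightarrow> b \<in> I \<Longrightarrow> a - b \<in> I"
    "\<And>a b. a - b \<in> I \<Longrightarrow> b \<in> I \<Longrightarrow> a \<in> I"
    "\<And>A F. (\<And>x. x \<in> A \<Longrightarrow> F x \<in> I) \<Longrightarrow> sum F A \<in> I"
proof -
  show 0: "0 \<in> I" and add: "\<And>a b. a \<in> I \<Longrightarrow> b \<in> I \<Longrightarrow> a + b \<in> I"
    and mult: "\<And>a r. a \<in> I \<Longrightarrow> r * a \<in> I"
    using assms by (auto simp: ring_ideal_def)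
  show "a - b \<in> I" if "a \<in> I" "b \<in> I" for a b
    using add[OF that(1) mult[OF that(2), of "-1"]] by simp
  show "a \<in> I" if "a - b \<in> I" "b \<in> I" for a b
    using add[OF that] by simp
  show "sum F A \<in> I" if "\<And>x. x \<in> A \<Longrightarrow> F x \<in> I" for F and A :: "'z set"
    using that by (induction A rule: infinite_finite_induct) (auto intro: 0 add)
qed

lemma ideal_iff_ring_ideal:
  "ideal I (ring_of_type_algebra :: 'a::comm_ring_1 ring) \<longleftrightarrow> ring_ideal I"
  unfolding ring_ideal_def
proof
  assume "ideal I (ring_of_type_algebra :: 'a ring)"
  then interpret ideal I "ring_of_type_algebra :: 'a ring" .
  show "0 \<in> I \<and> (\<forall>a\<in>I. \<forall>b\<in>I. a + b \<in> I) \<and> (\<forall>a\<in>I. \<forall>r. r * a \<in> I)"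
    using additive_subgroup.zero_closed[OF is_additive_subgroup]
      additive_subgroup.a_closed[OF is_additive_subgroup] I_l_closed
    by (simp add: ring_of_type_algebra_def)
next
  assume *: "0 \<in> I \<and> (\<forall>a\<in>I. \<forall>b\<in>I. a + b \<in> I) \<and> (\<forall>a\<in>I. \<forall>r. r * a \<in> I)"
  interpret cring "ring_of_type_algebra :: 'a ring" by (rule cring_from_type_algebra)
  have neg: "- a \<in> I" if "a \<in> I" for a using * that by (metis mult_minus1)
  show "ideal I (ring_of_type_algebra :: 'a ring)"
  proof (intro idealI)
    show "ring (ring_of_type_algebra :: 'a ring)" by unfold_locales
    show "subgroup I (add_monoid (ring_of_type_algebra :: 'a ring))"
    proof (intro group.subgroupI[OF a_group])
      fix a assume "a \<in> I"
      have "inv\<^bsub>add_monoid (ring_of_type_algebra :: 'a ring)\<^esub> a = - a"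
        by (rule group.inv_equality[OF a_group]) (auto simp: ring_of_type_algebra_def)
      then show "inv\<^bsub>add_monoid (ring_of_type_algebra :: 'a ring)\<^esub> a \<in> I"
        using neg \<open>a \<in> I\<close> by simp
    qed (use * in \<open>auto simp: ring_of_type_algebra_def\<close>)
  qed (use * in \<open>auto simp: ring_of_type_algebra_def mult.commute\<close>)
qed

text \<open>Gaussian elimination: more vectors than coordinates are dependent.\<close>

lemma linear_dependence:
  fixes h :: "'b \<Rightarrow> 'a \<Rightarrow> 'k::field"
  assumes "finite S" "finite C" "card S < card C"
  shows "\<exists>l. (\<exists>c\<in>C. l c \<noteq> 0) \<and> (\<forall>s\<in>S. (\<Sum>c\<in>C. l c * h c s) = 0)"
  using assms
proof (induction S arbitrary: C h rule: finite_induct)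
  case empty
  then have "C \<noteq> {}" by auto
  then show ?case by (intro exI[of _ "\<lambda>_. 1"]) auto
next
  case (insert s S)
  show ?case
  proof (cases "\<forall>c\<in>C. h c s = 0")
    case True
    have "\<exists>l. (\<exists>c\<in>C. l c \<noteq> 0) \<and> (\<forall>s\<in>S. (\<Sum>c\<in>C. l c * h c s) = 0)"
      using insert by (intro insert.IH) auto
    with True show ?thesis by auto
  next
    case False
    then obtain c0 where c0: "c0 \<in> C" "h c0 s \<noteq> 0" by auto
    \<comment> \<open>Eliminate coordinate \<open>s\<close> with the pivot \<open>h c0 s\<close>.\<close>
    define h' where "h' c t = h c t - h c s / h c0 s * h c0 t" for c t
    have "\<exists>l. (\<exists>c\<in>C - {c0}. l c \<noteq> 0) \<and> (\<forall>s\<in>S. (\<Sum>c\<in>C - {c0}. l c * h' c s) = 0)"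
      using insert c0 by (intro insert.IH) auto
    then obtain l c1 where l: "c1 \<in> C - {c0}" "l c1 \<noteq> 0"
      "\<And>t. t \<in> S \<Longrightarrow> (\<Sum>c\<in>C - {c0}. l c * h' c t) = 0" by blast
    define l' where "l' = l(c0 := - (\<Sum>c\<in>C - {c0}. l c * (h c s / h c0 s)))"
    have "(\<Sum>c\<in>C. l' c * h c t) = (\<Sum>c\<in>C - {c0}. l c * h' c t)" for t
    proof -
      have "(\<Sum>c\<in>C. l' c * h c t) = l' c0 * h c0 t + (\<Sum>c\<in>C - {c0}. l' c * h c t)"
        using insert.prems(1) c0(1) by (rule sum.remove)
      also have "(\<Sum>c\<in>C - {c0}. l' c * h c t) = (\<Sum>c\<in>C - {c0}. l c * h c t)"
        by (intro sum.cong) (auto simp: l'_def)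
      also have "l' c0 * h c0 t = - (\<Sum>c\<in>C - {c0}. l c * (h c s / h c0 s) * h c0 t)"
        by (simp add: l'_def sum_distrib_right)
      finally show ?thesis
        by (simp add: h'_def algebra_simps sum_subtractf)
    qed
    moreover have "h' c s = 0" for c using c0 by (simp add: h'_def)
    ultimately have "\<forall>t\<in>insert s S. (\<Sum>c\<in>C. l' c * h c t) = 0" using l(3) by simp
    moreover have "l' c1 \<noteq> 0" using l by (simp add: l'_def)
    ultimately show ?thesis using l(1) by blast
  qed
qed

text \<open>By Zorn's lemma. Adjoining \<open>g \<notin> J\<close> to a maximal \<open>J\<close> produces a power of \<open>f\<close>, so \<open>g\<close> is
invertible modulo \<open>J\<close> after localizing at \<open>f\<close>.\<close>

lemma exists_maximal_ideal_avoiding_powers: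
  assumes "ring_ideal I" "\<And>n. f ^ n \<notin> I"
  obtains J where "ring_ideal J" "I \<subseteq> J" "\<And>n. f ^ n \<notin> J"
    "\<And>g. g \<notin> J \<Longrightarrow> \<exists>n h. f ^ n - h * g \<in> J"
proof -
  define avoiders where "avoiders = {J. ring_ideal J \<and> I \<subseteq> J \<and> (\<forall>n. f ^ n \<notin> J)}"
  have "\<exists>M\<in>avoiders. \<forall>K\<in>avoiders. M \<subseteq> K \<longrightarrow> K = M"
  proof (rule subset_Zorn_nonempty)
    show "avoiders \<noteq> {}" using assms by (auto simp: avoiders_def)
    fix \<C> assume \<C>: "\<C> \<noteq> {}" "subset.chain avoiders \<C>"
    then have sub: "\<C> \<subseteq> avoiders" by (simp add: subset.chain_def)
    have ideal: "ring_ideal A" if "A \<in> \<C>" for A using that sub by (auto simp: avoiders_def)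
    have "ring_ideal (\<Union>\<C>)"
      unfolding ring_ideal_def
    proof (intro conjI ballI allI)
      show "0 \<in> \<Union>\<C>" using \<C>(1) ring_idealD(1)[OF ideal] by blast
      show "r * a \<in> \<Union>\<C>" if "a \<in> \<Union>\<C>" for a r
        using that ring_idealD(3)[OF ideal] by blast
      fix a b assume "a \<in> \<Union>\<C>" "b \<in> \<Union>\<C>"
      then obtain A B where AB: "A \<in> \<C>" "B \<in> \<C>" "a \<in> A" "b \<in> B" by auto
      have "A \<subseteq> B \<or> B \<subseteq> A" using \<C>(2) AB by (auto simp: subset_chain_def)
      with AB show "a + b \<in> \<Union>\<C>"
        using ring_idealD(2)[OF ideal] by blast
    qed
    moreover have "I \<subseteq> \<Union>\<C>" using \<C>(1) sub by (auto simp: avoiders_def)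
    moreover have "f ^ n \<notin> \<Union>\<C>" for n using sub by (auto simp: avoiders_def)
    ultimately show "\<Union>\<C> \<in> avoiders" by (auto simp: avoiders_def)
  qed
  then obtain J where "J \<in> avoiders" and max: "\<And>K. K \<in> avoiders \<Longrightarrow> J \<subseteq> K \<Longrightarrow> K = J" by blast
  then have J: "ring_ideal J" "I \<subseteq> J" "\<And>n. f ^ n \<notin> J" by (auto simp: avoiders_def)
  note id = ring_idealD[OF J(1)]
  have "\<exists>n h. f ^ n - h * g \<in> J" if g: "g \<notin> J" for g
  proof (rule ccontr)
    assume neg: "\<not> ?thesis"
    define K where "K = {x. \<exists>h. x - h * g \<in> J}"
    have "ring_ideal K"
      unfolding ring_ideal_def
    proof (intro conjI ballI allI)
      show "0 \<in> K" using id(1) by (auto simp: K_def intro!: exI[of _ 0])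
      fix a assume "a \<in> K"
      then obtain h where h: "a - h * g \<in> J" by (auto simp: K_def)
      show "r * a \<in> K" for r
        using id(3)[OF h, of r] by (auto simp: K_def algebra_simps intro!: exI[of _ "r * h"])
      fix b assume "b \<in> K"
      then obtain k where k: "b - k * g \<in> J" by (auto simp: K_def)
      show "a + b \<in> K"
        using id(2)[OF h k] by (auto simp: K_def algebra_simps intro!: exI[of _ "h + k"])
    qed
    moreover have sub: "J \<subseteq> K" by (auto simp: K_def intro!: exI[of _ 0])
    moreover have "f ^ n \<notin> K" for n using neg by (auto simp: K_def)
    ultimately have "K \<in> avoiders" using J(2) by (auto simp: avoiders_def)
    then have "K = J" using sub by (rule max)
    moreover have "g \<in> K" using id(1) by (auto simp: K_def intro!: exI[of _ 1])
    ultimately show False using g by simp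
  qed
  with J that show ?thesis by blast
qed

lemma maximal_avoiding_prime:
  assumes J: "ring_ideal J" "\<And>n. f ^ n \<notin> J" "\<And>g. g \<notin> J \<Longrightarrow> \<exists>n h. f ^ n - h * g \<in> J"
    and ab: "a * b \<in> J"
  shows "a \<in> J \<or> b \<in> J"
proof (rule ccontr)
  assume "\<not> ?thesis"
  then obtain n h m k where nh: "f ^ n - h * a \<in> J" and mk: "f ^ m - k * b \<in> J"
    using J(3) by blast
  note id = ring_idealD[OF J(1)]
  have "f ^ m * (f ^ n - h * a) + ((h * a) * (f ^ m - k * b) + (h * k) * (a * b)) \<in> J"
    by (intro id(2) id(3) nh mk ab)
  also have "f ^ m * (f ^ n - h * a) + ((h * a) * (f ^ m - k * b) + (h * k) * (a * b)) = f ^ (m + n)"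
    by (simp add: algebra_simps power_add)
  finally show False using J(2) by blast
qed

abbreviation const :: "complex \<Rightarrow> 'd::finite laurent" where
  "const c \<equiv> Poly_Mapping.single 0 c"

lemma const_mult: "const a * const b = (const (a * b) :: 'd::finite laurent)"
  by (simp add: mult_single)

lemma lookup_const_mult: "Poly_Mapping.lookup (const a * p) s = a * Poly_Mapping.lookup p s"
  by (simp add: mult_map_scale_conv_mult[symmetric] Poly_Mapping.map.rep_eq when_def)

text \<open>Substitution of a Laurent polynomial into a univariate polynomial.\<close>

definition poly_at :: "complex poly \<Rightarrow> 'd::finite laurent \<Rightarrow> 'd laurent" where
  "poly_at p x = poly (map_poly const p) x"

lemma poly_at_add:
  fixes x :: "'d::finite laurent"
  shows "poly_at (p + q) x = poly_at p x + poly_at q x"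
proof -
  have "map_poly const (p + q) = (map_poly const p + map_poly const q :: 'd::finite laurent poly)"
    by (rule poly_eqI) (simp add: coeff_map_poly single_add)
  then show ?thesis by (simp add: poly_at_def)
qed

lemma poly_at_smult:
  fixes x :: "'d::finite laurent"
  shows "poly_at (Polynomial.smult a p) x = const a * poly_at p x"
proof -
  have "map_poly const (Polynomial.smult a p) = (Polynomial.smult (const a) (map_poly const p) :: 'd::finite laurent poly)"
    by (rule poly_eqI) (simp add: coeff_map_poly const_mult)
  then show ?thesis by (simp add: poly_at_def)
qed

lemma poly_at_pCons: "poly_at (pCons a p) x = const a + x * poly_at p x"
  by (simp add: poly_at_def map_poly_pCons)

lemma poly_at_0 [simp]: "poly_at 0 x = 0"
  by (simp add: poly_at_def)

lemma poly_at_1 [simp]: "poly_at 1 x = 1"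
  by (simp add: one_pCons poly_at_pCons)

lemma poly_at_linear_mult: "poly_at ([:- c, 1:] * q) x = (x - const c) * poly_at q x"
proof -
  have "poly_at ([:- c, 1:] * q) x = poly_at (Polynomial.smult (- c) q + pCons 0 q) x"
    by (simp add: mult_pCons_left)
  then show ?thesis
    by (simp only: poly_at_add poly_at_smult poly_at_pCons) (simp add: algebra_simps single_uminus)
qed

lemma poly_at_prod_linear:
  "poly_at (\<Prod>c\<in>C. [:- c, 1:]) x = (\<Prod>c\<in>C. x - const c)"
  by (induction C rule: infinite_finite_induct) (simp_all add: poly_at_linear_mult del: mult_pCons_left)

lemma poly_at_sum: "poly_at (sum P C) x = (\<Sum>c\<in>C. poly_at (P c) x)"
  by (induction C rule: infinite_finite_induct) (auto simp: poly_at_add)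

text \<open>A nonzero complex polynomial splits into linear factors, and a prime ideal contains one of them.\<close>

lemma root_of_poly_at_in_prime:
  assumes "ring_ideal J" "1 \<notin> J" and prime: "\<And>a b. a * b \<in> J \<Longrightarrow> a \<in> J \<or> b \<in> J"
    and "p \<noteq> 0" "poly_at p x \<in> J"
  shows "\<exists>c. x - const c \<in> J"
  using assms(4,5)
proof (induction "Polynomial.degree p" arbitrary: p rule: less_induct)
  case less
  show ?case
  proof (cases "Polynomial.degree p = 0")
    case True
    then obtain a where a: "p = [:a:]" by (rule degree_eq_zeroE)
    then have "const a \<in> J" "a \<noteq> 0" using less.prems by (auto simp: poly_at_pCons)
    then have "const (inverse a) * const a \<in> J" using ring_idealD(3)[OF assms(1)] by blast
    with \<open>a \<noteq> 0\<close> assms(2) show ?thesis by (simp add: const_mult)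
  next
    case False
    then have "\<not> constant (poly p)" by (simp add: constant_degree)
    then obtain z where "poly p z = 0" using fundamental_theorem_of_algebra by blast
    then obtain q where q: "p = [:- z, 1:] * q" by (auto simp: poly_eq_0_iff_dvd)
    have "q \<noteq> 0" using q less.prems by auto
    then have "Polynomial.degree q < Polynomial.degree p" unfolding q by (subst degree_mult_eq) auto
    moreover have "x - const z \<in> J \<or> poly_at q x \<in> J"
      using less.prems(2) unfolding q poly_at_linear_mult by (rule prime)
    ultimately show ?thesis using less.hyps[of q] \<open>q \<noteq> 0\<close> by blast
  qed
qed

lemma infinite_fibre:
  fixes t :: "'a \<Rightarrow> 'b"
  assumes "uncountable (UNIV :: 'a set)" "countable (range t)"
  obtains y where "infinite {x. t x = y}"
proof -
  have "\<exists>y. infinite {x. t x = y}"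
  proof (rule ccontr)
    assume "\<not> ?thesis"
    then have "countable (\<Union>y\<in>range t. {x. t x = y})"
      by (intro countable_UN assms(2) countable_finite) auto
    also have "(\<Union>y\<in>range t. {x. t x = y}) = UNIV" by auto
    finally show False using assms(1) by simp
  qed
  with that show ?thesis by blast
qed

text \<open>This is where the uncountability of \<open>\<complex>\<close> replaces Noether normalization. If no \<open>x - c\<close> were in \<open>J\<close>, each would be
invertible modulo \<open>J\<close> up to a power of \<open>f\<close>, say \<open>f\<^sup>n \<equiv> h\<^sub>c (x - c)\<close>. There are only
countably many pairs of an exponent \<open>n\<close> and a support of \<open>h\<^sub>c\<close>, so infinitely many \<open>h\<^sub>c\<close> share both and
are linearly dependent. Clearing the denominators \<open>x - c\<close> in the dependence yields
a nonzero polynomial \<open>p\<close> with \<open>p(x) \<in> J\<close>, hence a linear factor in \<open>J\<close> after all.\<close>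

lemma constant_mod_maximal_avoiding:
  fixes J :: "'d::finite laurent set"
  assumes J: "ring_ideal J" "\<And>n. f ^ n \<notin> J" "\<And>g. g \<notin> J \<Longrightarrow> \<exists>n h. f ^ n - h * g \<in> J"
  shows "\<exists>c. x - const c \<in> J"
proof (rule ccontr)
  assume neg: "\<not> ?thesis"
  note prime = maximal_avoiding_prime[OF J]
  note id = ring_idealD[OF J(1)]
  have "\<exists>n h. f ^ n - h * (x - const c) \<in> J" for c using neg J(3) by blast
  then obtain n h where nh: "\<And>c. f ^ n c - h c * (x - const c) \<in> J" by metis
  \<comment> \<open>Pigeonhole: uncountably many constants, countably many values of \<open>t\<close>.\<close>
  define t where "t c = (n c, Poly_Mapping.keys (h c))" for c
  have "countable (UNIV \<times> {S :: (int ^ 'd) set. finite S \<and> S \<subseteq> UNIV} :: (nat \<times> _) set)"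
    by (intro countable_SIGMA countable_Collect_finite_subset) auto
  moreover have "range t \<subseteq> UNIV \<times> {S :: (int ^ 'd) set. finite S \<and> S \<subseteq> UNIV}"
    by (auto simp: t_def)
  ultimately have "countable (range t)" by (rule countable_subset[rotated])
  with uncountable_UNIV_complex obtain y where "infinite {c. t c = y}" by (rule infinite_fibre)
  then obtain m S where inf: "infinite {c. t c = (m, S)}" by (cases y) auto
  obtain C where C: "finite C" "card C = Suc (card S)" "C \<subseteq> {c. t c = (m, S)}"
    using infinite_arbitrarily_large[OF inf] by metis
  then have C_nS: "n c = m" "Poly_Mapping.keys (h c) = S" if "c \<in> C" for c
    using that by (auto simp: t_def)
  have "C \<noteq> {}" using C by auto
  then have "finite S" using C_nS(2) by (metis all_not_in_conv finite_keys)
  with C obtain l c0 where l: "c0 \<in> C" "l c0 \<noteq> 0"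
    "\<And>s. s \<in> S \<Longrightarrow> (\<Sum>c\<in>C. l c * Poly_Mapping.lookup (h c) s) = 0"
    using linear_dependence[of S C "\<lambda>c. Poly_Mapping.lookup (h c)"] by auto
  have rel: "(\<Sum>c\<in>C. const (l c) * h c) = 0"
  proof (rule poly_mapping_eqI)
    fix s
    have "(\<Sum>c\<in>C. l c * Poly_Mapping.lookup (h c) s) = 0"
    proof (cases "s \<in> S")
      case True then show ?thesis by (rule l(3))
    next
      case False
      then have "Poly_Mapping.lookup (h c) s = 0" if "c \<in> C" for c
        using C_nS(2)[OF that] in_keys_iff[of s "h c"] by simp
      then show ?thesis by simp
    qed
    then show "Poly_Mapping.lookup (\<Sum>c\<in>C. const (l c) * h c) s = Poly_Mapping.lookup 0 s"
      by (simp add: lookup_sum lookup_const_mult)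
  qed
  \<comment> \<open>The numerator of \<open>\<Sum>\<^sub>c l\<^sub>c / (X - c)\<close>, nonzero at \<open>c0\<close>.\<close>
  define p where "p = (\<Sum>c\<in>C. Polynomial.smult (l c) (\<Prod>c'\<in>C - {c}. [:- c', 1:]))"
  have "poly p c0 = (\<Sum>c\<in>C. l c * (\<Prod>c'\<in>C - {c}. c0 - c'))"
    by (simp add: p_def poly_sum poly_prod)
  also have "\<dots> = (\<Sum>c\<in>{c0}. l c * (\<Prod>c'\<in>C - {c}. c0 - c'))"
    using l(1) C(1) by (intro sum.mono_neutral_right) (auto intro!: prod_zero)
  also have "\<dots> \<noteq> 0" using l(2) C(1) by simp
  finally have "p \<noteq> 0" by auto
  have "f ^ m * poly_at p x =
     (\<Sum>c\<in>C. const (l c) * (\<Prod>c'\<in>C - {c}. x - const c') * (f ^ n c - h c * (x - const c)))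
     + (\<Sum>c\<in>C. const (l c) * h c) * (\<Prod>c\<in>C. x - const c)"
  proof -
    have "f ^ m * (const (l c) * (\<Prod>c'\<in>C - {c}. x - const c')) =
      const (l c) * (\<Prod>c'\<in>C - {c}. x - const c') * (f ^ n c - h c * (x - const c))
      + const (l c) * h c * (\<Prod>c\<in>C. x - const c)" if "c \<in> C" for c
      unfolding C_nS(1)[OF that] prod.remove[OF C(1) that, of "\<lambda>c. x - const c"] by (simp add: algebra_simps)
    then show ?thesis
      by (simp add: p_def poly_at_sum poly_at_smult poly_at_prod_linear sum_distrib_left
          sum_distrib_right sum.distrib[symmetric])
  qed
  also have "\<dots> \<in> J"
    unfolding rel mult_zero_left add_0_right by (intro id(6) id(3) nh)
  finally have "f ^ m * poly_at p x \<in> J" .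
  then have "poly_at p x \<in> J" using prime J(2) by blast
  then have "\<exists>c. x - const c \<in> J"
    using J(2)[of 0] \<open>p \<noteq> 0\<close> prime by (intro root_of_poly_at_in_prime[OF J(1)]) auto
  with neg show False by blast
qed

lemma character_eq_monomial_at:
  fixes ch :: "int ^ 'd::finite \<Rightarrow> complex"
  assumes add: "\<And>a b. ch (a + b) = ch a * ch b" and zero: "ch 0 = 1"
  shows "ch a = monomial_at (\<chi> i. ch (axis i 1)) a"
proof -
  have nz: "ch a \<noteq> 0" for a using add[of a "- a"] zero by auto
  have mult: "ch (k *s b) = ch b powi k" for k b
  proof (induction k rule: int_induct[of _ 0])
    case base then show ?case using zero by simp
  next
    case (step1 k)
    then show ?case using nz[of b] by (simp add: vector_sadd_rdistrib add power_int_add)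
  next
    case (step2 k)
    have "ch ((k - 1) *s b + b) = ch ((k - 1) *s b) * ch b" by (rule add)
    also have "(k - 1) *s b + b = k *s b" by (simp add: vec_eq_iff algebra_simps)
    finally show ?case using step2 nz[of b] by (simp add: power_int_diff field_simps)
  qed
  have sum: "ch (sum v I) = (\<Prod>i\<in>I. ch (v i))" for v and I :: "'d set"
    by (induction I rule: infinite_finite_induct) (auto simp: zero add)
  have "ch a = ch (\<Sum>i\<in>UNIV. a $ i *s axis i 1)" by (simp only: basis_expansion)
  then show ?thesis by (simp add: sum mult monomial_at_def)
qed

text \<open>Modulo an ideal that is maximal among those that contain \<open>I\<close> and miss all powers of \<open>f\<close>, every Laurent polynomial is congruent to a unique constant. The resulting ring homomorphism
to \<open>\<complex>\<close> is evaluation at the point whose coordinates are the constants of the variables.\<close>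

lemma nullstellensatz:
  fixes I :: "'d::finite laurent set"
  assumes I: "ring_ideal I" "\<And>n. f ^ n \<notin> I"
  obtains w :: "complex ^ 'd" where "\<And>i. w $ i \<noteq> 0" "\<And>g. g \<in> I \<Longrightarrow> laurent_eval g w = 0"
    "laurent_eval f w \<noteq> 0"
proof -
  obtain J where J: "ring_ideal J" "I \<subseteq> J" "\<And>n. f ^ n \<notin> J"
    "\<And>g. g \<notin> J \<Longrightarrow> \<exists>n h. f ^ n - h * g \<in> J"
    using exists_maximal_ideal_avoiding_powers[OF I] by metis
  note id = ring_idealD[OF J(1)]
  obtain \<psi> where \<psi>: "\<And>x. x - const (\<psi> x) \<in> J"
    using constant_mod_maximal_avoiding[OF J(1,3,4)] by metis
  have const_in_J: "c = 0" if "const c \<in> J" for c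
  proof (rule ccontr)
    assume "c \<noteq> 0"
    have "const (inverse c) * const c \<in> J" using that by (rule id(3))
    with \<open>c \<noteq> 0\<close> show False using J(3)[of 0] by (simp add: const_mult)
  qed
  have eqI: "\<psi> x = c" if "x - const c \<in> J" for x c
  proof -
    have "(x - const c) - (x - const (\<psi> x)) \<in> J" using that \<psi> by (rule id(4))
    then have "const (\<psi> x - c) \<in> J" by (simp add: single_diff)
    then show ?thesis using const_in_J by force
  qed
  have add: "\<psi> (x + y) = \<psi> x + \<psi> y" for x y
    using id(2)[OF \<psi>[of x] \<psi>[of y]] by (intro eqI) (simp add: single_add algebra_simps)
  have mult: "\<psi> (x * y) = \<psi> x * \<psi> y" for x y
  proof (rule eqI)
    have "x * (y - const (\<psi> y)) + const (\<psi> y) * (x - const (\<psi> x)) \<in> J"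
      by (intro id(2) id(3) \<psi>)
    then show "x * y - const (\<psi> x * \<psi> y) \<in> J"
      by (simp add: const_mult[symmetric] algebra_simps)
  qed
  have const: "\<psi> (const c) = c" for c using id(1) by (intro eqI) simp
  have sum: "\<psi> (sum F A) = (\<Sum>a\<in>A. \<psi> (F a))" for F :: "'z \<Rightarrow> _" and A
    by (induction A rule: infinite_finite_induct) (use const[of 0] in \<open>auto simp: add\<close>)
  define w where "w = (\<chi> i. \<psi> (Poly_Mapping.single (axis i 1) 1))"
  have mono: "\<psi> (Poly_Mapping.single a 1) = monomial_at w a" for a
    unfolding w_def
    by (rule character_eq_monomial_at)
       (use const[of 1] in \<open>simp_all add: mult[symmetric] mult_single\<close>)
  have eval: "\<psi> g = laurent_eval g w" for g
  proof -
    have "\<psi> (Poly_Mapping.single a c) = c * monomial_at w a" for a c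
      using mult[of "const c" "Poly_Mapping.single a 1"] by (simp add: mult_single const mono)
    then show ?thesis
      by (subst laurent_expansion) (simp add: sum laurent_eval_def)
  qed
  show ?thesis
  proof (rule that)
    show "w $ i \<noteq> 0" for i
    proof -
      have "\<psi> (Poly_Mapping.single (axis i 1) 1) * \<psi> (Poly_Mapping.single (- axis i 1) 1) = 1"
        using const[of 1] by (simp add: mult[symmetric] mult_single)
      then show ?thesis by (auto simp: w_def)
    qed
    show "laurent_eval g w = 0" if "g \<in> I" for g
      using that J(2) by (auto simp: eval[symmetric] intro!: eqI)
    show "laurent_eval f w \<noteq> 0"
      using \<psi>[of f] J(3)[of 1] by (auto simp: eval[symmetric])
  qed
qed

section \<open>Moving zeros onto the torus\<close>

text \<open>Linear combinations of the given relations replace \<open>t v ^ Suc j\<close> by \<open>t v * p (t v)\<close> for any polynomial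
\<open>p\<close>; one that vanishes at all nodes except \<open>t v\<close> isolates \<open>F v\<close>.\<close>

lemma vandermonde_injective:
  fixes F t :: "'a \<Rightarrow> complex"
  assumes "finite V" "inj_on t V" "\<And>v. v \<in> V \<Longrightarrow> t v \<noteq> 0"
    and sums: "\<And>j. (\<Sum>v\<in>V. F v * t v ^ Suc j) = 0" and v: "v \<in> V"
  shows "F v = 0"
proof -
  define p where "p = (\<Prod>u\<in>V - {v}. [:- t u, 1:])"
  have "(\<Sum>u\<in>V. F u * t u * poly p (t u)) = (\<Sum>i\<le>Polynomial.degree p. Polynomial.coeff p i * (\<Sum>u\<in>V. F u * t u ^ Suc i))"
    unfolding poly_altdef sum_distrib_left
    by (subst sum.swap) (simp add: mult_ac)
  also have "\<dots> = 0" by (simp only: sums mult_zero_right sum.neutral_const)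
  also have "(\<Sum>u\<in>V. F u * t u * poly p (t u)) = (\<Sum>u\<in>{v}. F u * t u * poly p (t u))"
    using assms(1) v by (intro sum.mono_neutral_right) (auto simp: p_def poly_prod intro!: prod_zero)
  finally have "F v * t v * poly p (t v) = 0" by simp
  moreover have "poly p (t v) \<noteq> 0"
    using assms(1,2) v by (auto simp: p_def poly_prod inj_on_def)
  ultimately show ?thesis using assms(3)[OF v] by simp
qed

text \<open>The coefficient of \<open>v\<^sup>j\<close> in \<open>g(w\<^sup>j)\<close>, when monomials with equal values at \<open>w\<close> are collected.\<close>

definition fibre_sum :: "'d::finite laurent \<Rightarrow> complex ^ 'd \<Rightarrow> complex \<Rightarrow> complex" where
  "fibre_sum g w v = (\<Sum>a | a \<in> Poly_Mapping.keys g \<and> monomial_at w a = v. Poly_Mapping.lookup g a)"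

lemma laurent_eval_fibres:
  assumes "\<And>a. monomial_at z a = t (monomial_at w a)"
  shows "laurent_eval g z = (\<Sum>v\<in>monomial_at w ` Poly_Mapping.keys g. fibre_sum g w v * t v)"
proof -
  have "laurent_eval g z = (\<Sum>v\<in>monomial_at w ` Poly_Mapping.keys g.
      \<Sum>a | a \<in> Poly_Mapping.keys g \<and> monomial_at w a = v. Poly_Mapping.lookup g a * t (monomial_at w a))"
    unfolding laurent_eval_def assms by (rule sum.image_gen) simp
  also have "\<dots> = (\<Sum>v\<in>monomial_at w ` Poly_Mapping.keys g. fibre_sum g w v * t v)"
    by (simp add: fibre_sum_def sum_distrib_right)
  finally show ?thesis .
qed

text \<open>A one-parameter family of homomorphisms \<open>\<complex>\<^sup>* \<rightarrow> T\<close>, \<open>r e\<^sup>i\<^sup>\<theta> \<mapsto> e\<^sup>i\<^sup>\<theta> r\<^sup>i\<^sup>s\<close>.\<close>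

definition twist :: "real \<Rightarrow> complex \<Rightarrow> complex" where
  "twist s v = sgn v * cis (s * ln (norm v))"

lemma twist_mult: "u \<noteq> 0 \<Longrightarrow> v \<noteq> 0 \<Longrightarrow> twist s (u * v) = twist s u * twist s v"
  by (simp add: twist_def sgn_mult norm_mult ln_mult cis_mult[symmetric] algebra_simps)

lemma norm_twist: "v \<noteq> 0 \<Longrightarrow> norm (twist s v) = 1"
  by (simp add: twist_def norm_mult norm_sgn)

lemma monomial_at_twist:
  fixes w :: "complex ^ 'd::finite"
  assumes "\<And>i. w $ i \<noteq> 0"
  shows "monomial_at (\<chi> i. twist s (w $ i)) a = twist s (monomial_at w a)"
proof -
  have axis: "monomial_at w (axis i 1) = w $ i" for i
  proof -
    have "w $ k powi axis i 1 $ k = (if k = i then w $ i else 1)" for k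
      by (simp add: axis_def)
    then have "monomial_at w (axis i 1) = (\<Prod>k\<in>UNIV. if k = i then w $ i else 1)"
      by (simp only: monomial_at_def)
    then show ?thesis by simp
  qed
  have "twist s (monomial_at w a) = monomial_at (\<chi> i. twist s (monomial_at w (axis i 1))) a"
    using monomial_at_nonzero[OF assms]
    by (intro character_eq_monomial_at) (simp_all add: monomial_at_add[OF assms] twist_mult, simp add: twist_def)
  then show ?thesis by (simp only: axis)
qed

text \<open>For distinct directions the values are already distinct in the limit \<open>s \<rightarrow> 0\<close>. For equal directions the moduli
differ, and the angles \<open>s ln \<bar>u\<bar>\<close> and \<open>s ln \<bar>v\<bar>\<close> differ by less than a full turn when \<open>s\<close> is small.\<close>

lemma twist_separates:
  assumes "u \<noteq> 0" "v \<noteq> 0" "u \<noteq> v"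
  shows "eventually (\<lambda>s. twist s u \<noteq> twist s v) (at_right 0)"
proof (cases "sgn u = sgn v")
  case False
  have "((\<lambda>s. twist s u - twist s v) \<longlongrightarrow> sgn u * cis (0 * ln (norm u)) - sgn v * cis (0 * ln (norm v))) (at_right 0)"
    unfolding twist_def cis_conv_exp by (intro tendsto_intros)
  then have "eventually (\<lambda>s. twist s u - twist s v \<noteq> 0) (at_right 0)"
    using False by (intro tendsto_imp_eventually_ne) auto
  then show ?thesis by eventually_elim simp
next
  case True
  define L where "L = ln (norm u) - ln (norm v)"
  have "norm u \<noteq> norm v"
  proof
    assume "norm u = norm v"
    with True assms have "u = v" by (simp add: sgn_eq)
    with assms(3) show False ..
  qed
  then have L: "L \<noteq> 0" using assms by (simp add: L_def)
  have "eventually (\<lambda>s. s < 1 / \<bar>L\<bar>) (at_right (0::real))"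
    using L by (intro eventually_at_right_real[THEN eventually_mono] ) auto
  then show ?thesis
    using eventually_at_right_less[of 0]
  proof eventually_elim
    case (elim s)
    show ?case
    proof
      assume "twist s u = twist s v"
      then have "cis (s * ln (norm u)) = cis (s * ln (norm v))"
        using True assms by (simp add: twist_def sgn_zero_iff)
      then have "cis (s * L) = 1"
        by (simp add: L_def right_diff_distrib cis_divide[symmetric])
      then have "cos (s * L) = 1" by (metis Re_complex_of_real cis.sel(1) of_real_1)
      then obtain n where n: "s * L = of_int n * 2 * pi" by (auto simp: cos_one_2pi_int)
      have "\<bar>s * L\<bar> < 1" using elim L by (simp add: abs_mult field_simps)
      moreover have "\<bar>of_int n * 2 * pi\<bar> \<ge> 1" if "n \<noteq> 0"
      proof -
        have "1 * 1 \<le> \<bar>real_of_int n\<bar> * (2 * pi)"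
          using that pi_gt3 by (intro mult_mono) auto
        then show ?thesis by (simp add: abs_mult)
      qed
      ultimately have "n = 0" using n by fastforce
      with n elim L show False by simp
    qed
  qed
qed

lemma exists_injective_twist:
  assumes "finite V" "0 \<notin> V"
  shows "\<exists>s. inj_on (twist s) V"
proof -
  have "eventually (\<lambda>s. \<forall>p\<in>{p\<in>V \<times> V. fst p \<noteq> snd p}. twist s (fst p) \<noteq> twist s (snd p)) (at_right (0::real))"
    using assms by (intro eventually_ball_finite ballI twist_separates) auto
  then obtain s where "\<forall>p\<in>{p\<in>V \<times> V. fst p \<noteq> snd p}. twist s (fst p) \<noteq> twist s (snd p)"
    by (rule eventually_happens'[OF trivial_limit_at_right_real, THEN exE])
  then show ?thesis by (intro exI[of _ s]) (auto simp: inj_on_def)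
qed

text \<open>Vandermonde along the powers of \<open>w\<close> shows that all fibre sums of \<open>g \<in> I\<close> vanish, so \<open>g\<close> vanishes at the
image of \<open>w\<close> under every homomorphism \<open>\<complex>\<^sup>* \<rightarrow> T\<close>. Some fibre sum of \<open>f\<close> is nonzero; if the homomorphism is injective
on the values of the monomials of \<open>f\<close>, Vandermonde along the powers of the image finds a power at which \<open>f\<close> does
not vanish.\<close>

lemma torus_zero_of_power_closed:
  fixes I :: "'d::finite laurent set"
  assumes "power_closed I" and w: "\<And>i. w $ i \<noteq> 0"
    and vanish: "\<And>g. g \<in> I \<Longrightarrow> laurent_eval g w = 0" and f: "laurent_eval f w \<noteq> 0"
  obtains z where "z \<in> torus" "\<And>g. g \<in> I \<Longrightarrow> laurent_eval g z = 0" "laurent_eval f z \<noteq> 0"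
proof -
  let ?M = "\<lambda>g. monomial_at w ` Poly_Mapping.keys g"
  have nz: "v \<noteq> 0" if "v \<in> ?M g" for v g using that monomial_at_nonzero[OF w] by auto
  have fibre: "fibre_sum g w v = 0" if "g \<in> I" "v \<in> ?M g" for g v
  proof (rule vandermonde_injective[where V = "?M g" and t = "\<lambda>v. v" and F = "fibre_sum g w"])
    fix j
    have "power_subst (Suc j) g \<in> I" using assms(1) that(1) by (simp add: power_closed_def)
    then have "0 = laurent_eval g (torus_power (Suc j) w)"
      using vanish by (simp only: laurent_eval_power_subst[symmetric])
    also have "\<dots> = (\<Sum>v\<in>?M g. fibre_sum g w v * v ^ Suc j)"
      by (rule laurent_eval_fibres) (rule monomial_at_torus_power)
    finally show "(\<Sum>v\<in>?M g. fibre_sum g w v * v ^ Suc j) = 0" ..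
  qed (use that nz in auto)
  have "0 \<notin> ?M f"
  proof
    assume "0 \<in> ?M f"
    then have "(0 :: complex) \<noteq> 0" by (rule nz)
    then show False by simp
  qed
  then have "\<exists>s. inj_on (twist s) (?M f)" by (intro exists_injective_twist) simp
  then obtain s where s: "inj_on (twist s) (?M f)" ..
  define z where "z j = torus_power (Suc j) (\<chi> i. twist s (w $ i))" for j
  have eval: "laurent_eval g (z j) = (\<Sum>v\<in>?M g. fibre_sum g w v * twist s v ^ Suc j)" for g j
    unfolding z_def
    by (rule laurent_eval_fibres) (simp only: monomial_at_torus_power monomial_at_twist[OF w])
  have "\<exists>j. laurent_eval f (z j) \<noteq> 0"
  proof (rule ccontr)
    assume none: "\<not> ?thesis"
    have "fibre_sum f w v = 0" if "v \<in> ?M f" for v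
    proof (rule vandermonde_injective[where V = "?M f" and t = "twist s" and F = "fibre_sum f w"])
      show "twist s u \<noteq> 0" if "u \<in> ?M f" for u using norm_twist[OF nz[OF that], of s] by auto
      show "(\<Sum>v\<in>?M f. fibre_sum f w v * twist s v ^ Suc j) = 0" for j
        using none unfolding eval by blast
    qed (use s that in simp_all)
    then have "laurent_eval f w = 0" using laurent_eval_fibres[of w "\<lambda>v. v" w f] by simp
    with f show False ..
  qed
  then obtain j where "laurent_eval f (z j) \<noteq> 0" ..
  moreover have "laurent_eval g (z j) = 0" if "g \<in> I" for g
    by (simp add: eval fibre[OF that])
  moreover have "z j \<in> torus"
    unfolding z_def using w by (intro torus_power_in_torus) (simp add: torus_def norm_twist)
  ultimately show ?thesis using that by blast
qed

section \<open>The correspondence\<close>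

definition vanishing_ideal :: "(complex ^ 'd::finite) set \<Rightarrow> 'd laurent set" where
  "vanishing_ideal Z = {f. \<forall>z\<in>Z. laurent_eval f z = 0}"

lemma vanishing_ideal_radical_power_closed:
  fixes Z :: "(complex ^ 'd::finite) set"
  assumes Z: "Z \<in> closed_power_sets"
  shows "vanishing_ideal Z \<in> radical_power_closed_ideals"
proof -
  have nz: "z $ i \<noteq> 0" if "z \<in> Z" for z i
    using torus_nonzero[of z i] closed_power_setsD(1)[OF Z] that by blast
  have mult: "laurent_eval (f * g) z = laurent_eval f z * laurent_eval g z" if "z \<in> Z" for f g z
    using nz[OF that] by (rule laurent_eval_mult)
  have power: "laurent_eval (f ^ n) z = laurent_eval f z ^ n" if "z \<in> Z" for f n z
    using nz[OF that] by (rule laurent_eval_power)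
  have "ring_ideal (vanishing_ideal Z)"
    by (simp add: ring_ideal_def vanishing_ideal_def mult)
  moreover have "ideal_radical (vanishing_ideal Z) = vanishing_ideal Z"
  proof
    show "ideal_radical (vanishing_ideal Z) \<subseteq> vanishing_ideal Z"
      by (auto simp: ideal_radical_def vanishing_ideal_def power)
    show "vanishing_ideal Z \<subseteq> ideal_radical (vanishing_ideal Z)"
      unfolding ideal_radical_def by (auto intro!: exI[of _ 1])
  qed
  moreover have "power_closed (vanishing_ideal Z)"
    using Z by (auto simp: power_closed_def vanishing_ideal_def laurent_eval_power_subst closed_power_sets_def)
  ultimately show ?thesis
    by (simp add: radical_power_closed_ideals_def ideal_iff_ring_ideal)
qed

text \<open>The product of the binomials \<open>x\<^sup>a - 1\<close> over separating exponents with \<open>w\<^sup>a \<noteq> 1\<close>.\<close>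

lemma vanishing_ideal_separates:
  fixes Z :: "(complex ^ 'd::finite) set"
  assumes Z: "Z \<in> closed_power_sets" and w: "w \<in> torus" "w \<notin> Z"
  shows "\<exists>f\<in>vanishing_ideal Z. laurent_eval f w \<noteq> 0"
proof -
  obtain F where F: "finite F"
    "\<forall>z\<in>Z. \<exists>a\<in>F. monomial_at z a = 1 \<and> monomial_at w a \<noteq> 1"
    using separating_exponents[OF assms] by (elim exE conjE)
  define f where "f = (\<Prod>a\<in>{a\<in>F. monomial_at w a \<noteq> 1}. Poly_Mapping.single a 1 + const (- 1))"
  have eval: "laurent_eval f z = (\<Prod>a\<in>{a\<in>F. monomial_at w a \<noteq> 1}. monomial_at z a - 1)" if "z \<in> torus" for z
    unfolding f_def using torus_nonzero[OF that] by (subst laurent_eval_prod) simp_all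
  have "laurent_eval f z = 0" if z: "z \<in> Z" for z
  proof -
    obtain a where a: "a \<in> F" "monomial_at z a = 1" "monomial_at w a \<noteq> 1" using F(2) z by blast
    have "z \<in> torus" using closed_power_setsD(1)[OF Z] z by blast
    moreover have "(\<Prod>a\<in>{a\<in>F. monomial_at w a \<noteq> 1}. monomial_at z a - 1) = 0"
      using a F(1) by (intro prod_zero) auto
    ultimately show ?thesis by (simp only: eval)
  qed
  moreover have "laurent_eval f w \<noteq> 0" using F(1) by (simp add: eval[OF w(1)])
  ultimately show ?thesis by (auto simp: vanishing_ideal_def)
qed

lemma vanishing_ideal_subset_iff:
  fixes Z Z' :: "(complex ^ 'd::finite) set"
  assumes "Z \<in> closed_power_sets" "Z' \<in> closed_power_sets"
  shows "Z \<subseteq> Z' \<longleftrightarrow> vanishing_ideal Z' \<subseteq> vanishing_ideal Z"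
proof
  show "vanishing_ideal Z' \<subseteq> vanishing_ideal Z" if "Z \<subseteq> Z'"
    using that by (auto simp: vanishing_ideal_def)
  assume sub: "vanishing_ideal Z' \<subseteq> vanishing_ideal Z"
  show "Z \<subseteq> Z'"
  proof
    fix w assume w: "w \<in> Z"
    show "w \<in> Z'"
    proof (rule ccontr)
      assume "w \<notin> Z'"
      moreover have "w \<in> torus" using closed_power_setsD(1)[OF assms(1)] w by blast
      ultimately obtain f where "f \<in> vanishing_ideal Z'" "laurent_eval f w \<noteq> 0"
        using vanishing_ideal_separates[OF assms(2)] by blast
      with sub w show False by (auto simp: vanishing_ideal_def)
    qed
  qed
qed

text \<open>The set \<open>Z\<close> is the part of the zero locus of \<open>I\<close> on the torus. The Nullstellensatz followed by
the move onto the torus shows that \<open>Z\<close> retains enough zeros to detect membership in \<open>I\<close>.\<close>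

lemma radical_power_closed_ideal_eq_vanishing_ideal:
  fixes I :: "'d::finite laurent set"
  assumes "I \<in> radical_power_closed_ideals"
  shows "\<exists>Z\<in>closed_power_sets. vanishing_ideal Z = I"
proof -
  have I: "ring_ideal I" "ideal_radical I = I" "power_closed I"
    using assms by (simp_all add: radical_power_closed_ideals_def ideal_iff_ring_ideal)
  define Z where "Z = {z\<in>torus. \<forall>g\<in>I. laurent_eval g z = 0}"
  have "closedin (top_of_set torus) (\<Inter>g\<in>I. {z\<in>torus. laurent_eval g z = 0})"
  proof (rule closedin_INT)
    show "I \<noteq> {}" using ring_idealD(1)[OF I(1)] by auto
    fix g show "closedin (top_of_set torus) {z \<in> torus. laurent_eval g z = 0}"
      unfolding laurent_eval_def
      by (intro continuous_closedin_preimage_constant continuous_intros continuous_on_monomial_at)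
  qed
  also have "(\<Inter>g\<in>I. {z\<in>torus. laurent_eval g z = 0}) = Z"
    using ring_idealD(1)[OF I(1)] by (auto simp: Z_def)
  finally have "closedin (top_of_set torus) Z" .
  moreover have "torus_power j z \<in> Z" if "j \<ge> 1" "z \<in> Z" for j z
    using that I(3) unfolding Z_def power_closed_def
    by (auto simp: torus_power_in_torus laurent_eval_power_subst[symmetric])
  ultimately have "Z \<in> closed_power_sets" by (simp add: closed_power_sets_def)
  moreover have "vanishing_ideal Z = I"
  proof
    show "I \<subseteq> vanishing_ideal Z" by (auto simp: vanishing_ideal_def Z_def)
    show "vanishing_ideal Z \<subseteq> I"
    proof
      fix f assume f: "f \<in> vanishing_ideal Z"
      show "f \<in> I"
      proof (rule ccontr)
        assume "f \<notin> I"
        have powers: "f ^ n \<notin> I" for n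
        proof
          assume n: "f ^ n \<in> I"
          have "f * f ^ n \<in> I" using n by (rule ring_idealD(3)[OF I(1)])
          then have "f ^ Suc n \<in> I" by simp
          then have "f \<in> ideal_radical I" unfolding ideal_radical_def by (auto intro!: exI[of _ "Suc n"])
          with I(2) \<open>f \<notin> I\<close> show False by simp
        qed
        obtain w where w: "\<And>i. w $ i \<noteq> 0" "\<And>g. g \<in> I \<Longrightarrow> laurent_eval g w = 0" "laurent_eval f w \<noteq> 0"
          using nullstellensatz[OF I(1) powers] by metis
        obtain z where "z \<in> torus" "\<And>g. g \<in> I \<Longrightarrow> laurent_eval g z = 0" "laurent_eval f z \<noteq> 0"
          using torus_zero_of_power_closed[OF I(3) w] by metis
        then show False using f by (auto simp: vanishing_ideal_def Z_def)
      qed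
    qed
  qed
  ultimately show ?thesis by blast
qed

theorem theorem7p4:
  shows "(\<exists>\<Phi> :: (complex ^ 'd::finite) set \<Rightarrow> 'd laurent set.
            bij_betw \<Phi> closed_power_sets radical_power_closed_ideals \<and>
            (\<forall>Z\<in>closed_power_sets. \<forall>Z'\<in>closed_power_sets. Z \<subseteq> Z' \<longleftrightarrow> \<Phi> Z' \<subseteq> \<Phi> Z))
       \<and> (closed_power_sets :: (complex ^ 'd) set set) =
           {\<Union>\<H> | \<H>. finite \<H> \<and>
              (\<forall>H\<in>\<H>. subgroup H torus_group \<and> closedin (top_of_set torus) H)}"
proof (intro conjI exI[of _ vanishing_ideal] ballI)
  show "bij_betw vanishing_ideal (closed_power_sets :: (complex ^ 'd) set set) radical_power_closed_ideals"
    unfolding bij_betw_def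
  proof
    show "inj_on vanishing_ideal (closed_power_sets :: (complex ^ 'd) set set)"
      by (intro inj_onI equalityI) (simp_all add: vanishing_ideal_subset_iff)
    show "vanishing_ideal ` closed_power_sets = (radical_power_closed_ideals :: 'd laurent set set)"
      using vanishing_ideal_radical_power_closed radical_power_closed_ideal_eq_vanishing_ideal by blast
  qed
qed (fact vanishing_ideal_subset_iff closed_power_sets_eq)+

end
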